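(* Let $1<p<\infty$ and $0\leq\lambda<n$. Let $S$ be a singular integral operator $$Sf(x):=\lim_{\varepsilon\to0}\int_{|x-y|>\varepsilon}K(x,y)f(y)\,dy$$ which is bounded in $L^p(\mathbb{R}^n)$ and whose kernel satisfies $|K(x,y)|\leq c\,|x-y|^{-n}$ for all $x\neq y$, for some constant $c>0$. Then $S$ is bounded from $V_{0,\infty}^{(\ast)}L^{p,\lambda}(\mathbb{R}^n)$ into itself; that is, $Sf\in V_{0,\infty}^{(\ast)}L^{p,\lambda}(\mathbb{R}^n)$ for every $f\in V_{0,\infty}^{(\ast)}L^{p,\lambda}(\mathbb{R}^n)$, and $\|Sf\|_{p,\lambda}\leq C\|f\|_{p,\lambda}$ with $C$ independent of $f$.
   Context: For $x\in\mathbb{R}^n$, $r>0$, let $B(x,r)$ be the open ball and $\mathfrak{M}_{p,\lambda}(f;x,r):=\frac{1}{r^\lambda}\int_{B(x,r)}|f(y)|^p\,dy$. The Morrey space $L^{p,\lambda}(\mathbb{R}^n)$ consists of all locally $p$-integrable $f$ on $\mathbb{R}^n$ with $\|f\|_{p,\lambda}:=\sup_{x\in\mathbb{R}^n,\,r>0}\mathfrak{M}_{p,\lambda}(f;x,r)^{1/p}<\infty$. The subspace $V_{0,\infty}^{(\ast)}L^{p,\lambda}(\mathbb{R}^n)$ consists of all $f\in L^{p,\lambda}(\mathbb{R}^n)$ satisfying all three of the properties: - $(V_0)$: $\lim_{r\to0}\sup_{x\in\mathbb{R}^n}\mathfrak{M}_{p,\lambda}(f;x,r)=0$; - $(V_\infty)$: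 $\lim_{r\to\infty}\sup_{x\in\mathbb{R}^n}\mathfrak{M}_{p,\lambda}(f;x,r)=0$; - $(V^\ast)$: $\lim_{N\to\infty}\sup_{x\in\mathbb{R}^n}\int_{B(x,1)}|f(y)|^p\,\chi_{\mathbb{R}^n\setminus B(0,N)}(y)\,dy=0$. The kernel $K$ is measurable and the limit defining $Sf(x)$ is understood to exist for a.e. $x$ for $f\in L^p(\mathbb{R}^n)$. *)

theory Defs
  imports "HOL-Analysis.Analysis"
begin

text \<open>
  Spaces of functions are sets of Lebesgue measurable functions; functions that agree almost
  everywhere are not identified.  The scalars range over a type of class
  \<open>{real_normed_field, euclidean_space}\<close>, which covers both \<^typ>\<open>real\<close> and \<^typ>\<open>complex\<close>.
\<close>

definition Lp_space :: "real \<Rightarrow> ('a::euclidean_space \<Rightarrow> 'b::euclidean_space) set" where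
  "Lp_space p =
     {f \<in> borel_measurable lebesgue. integrable lebesgue (\<lambda>y. norm (f y) powr p)}"

definition Lp_norm :: "real \<Rightarrow> ('a::euclidean_space \<Rightarrow> 'b::euclidean_space) \<Rightarrow> real" where
  "Lp_norm p f = (LINT y|lebesgue. norm (f y) powr p) powr (1 / p)"

definition locally_p_integrable ::
    "real \<Rightarrow> ('a::euclidean_space \<Rightarrow> 'b::euclidean_space) \<Rightarrow> bool" where
  "locally_p_integrable p f \<longleftrightarrow>
     f \<in> borel_measurable lebesgue \<and>
     (\<forall>C. compact C \<longrightarrow> set_integrable lebesgue C (\<lambda>y. norm (f y) powr p))"

definition morrey_mean ::
    "real \<Rightarrow> real \<Rightarrow> ('a::euclidean_space \<Rightarrow> 'b::euclidean_space) \<Rightarrow> 'a \<Rightarrow> real \<Rightarrow> real" where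
  "morrey_mean p l f x r = 1 / r powr l * (LINT y:ball x r|lebesgue. norm (f y) powr p)"

text \<open>
  The suprema below are taken in \<^typ>\<open>real\<close>, where they are only meaningful for bounded sets.
  Finiteness of the Morrey norm is therefore part of \<open>morrey_space\<close>, as the condition
  \<open>bdd_above\<close>; it also bounds, for members of the space, the suprema in the vanishing conditions.
\<close>

definition morrey_space ::
    "real \<Rightarrow> real \<Rightarrow> ('a::euclidean_space \<Rightarrow> 'b::euclidean_space) set" where
  "morrey_space p l =
     {f. locally_p_integrable p f \<and>
         bdd_above ((\<lambda>(x, r). morrey_mean p l f x r powr (1 / p)) ` (UNIV \<times> {0<..}))}"

definition morrey_norm ::
    "real \<Rightarrow> real \<Rightarrow> ('a::euclidean_space \<Rightarrow> 'b::euclidean_space) \<Rightarrow> real" where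
  "morrey_norm p l f = (SUP (x, r)\<in>UNIV \<times> {0<..}. morrey_mean p l f x r powr (1 / p))"

definition vanishing_zero ::
    "real \<Rightarrow> real \<Rightarrow> ('a::euclidean_space \<Rightarrow> 'b::euclidean_space) \<Rightarrow> bool" where
  "vanishing_zero p l f \<longleftrightarrow> ((\<lambda>r. SUP x. morrey_mean p l f x r) \<longlongrightarrow> 0) (at_right 0)"

definition vanishing_infinity ::
    "real \<Rightarrow> real \<Rightarrow> ('a::euclidean_space \<Rightarrow> 'b::euclidean_space) \<Rightarrow> bool" where
  "vanishing_infinity p l f \<longleftrightarrow> ((\<lambda>r. SUP x. morrey_mean p l f x r) \<longlongrightarrow> 0) at_top"

definition vanishing_star ::
    "real \<Rightarrow> ('a::euclidean_space \<Rightarrow> 'b::euclidean_space) \<Rightarrow> bool" where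
  "vanishing_star p f \<longleftrightarrow>
     ((\<lambda>N::real. SUP x. LINT y:ball x 1|lebesgue.
          norm (f y) powr p * indicator (UNIV - ball 0 N) y) \<longlongrightarrow> 0) at_top"

definition vanishing_morrey_space ::
    "real \<Rightarrow> real \<Rightarrow> ('a::euclidean_space \<Rightarrow> 'b::euclidean_space) set" where
  "vanishing_morrey_space p l =
     {f \<in> morrey_space p l.
        vanishing_zero p l f \<and> vanishing_infinity p l f \<and> vanishing_star p f}"

definition truncated_integral ::
    "('a::euclidean_space \<Rightarrow> 'a \<Rightarrow> 'b::{real_normed_field, euclidean_space}) \<Rightarrow>
     ('a \<Rightarrow> 'b) \<Rightarrow> 'a \<Rightarrow> real \<Rightarrow> 'b" where
  "truncated_integral K f x \<epsilon> = (LINT y:{y. dist x y > \<epsilon>}|lebesgue. K x y * f y)"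

text \<open>
  The Bochner integral of a non-integrable function is \<open>0\<close> and \<open>Lim\<close> of a divergent function is
  arbitrary, so the existence of the truncated integrals and of their limit is stated separately
  from the value.
\<close>

definition singular_integral_exists ::
    "('a::euclidean_space \<Rightarrow> 'a \<Rightarrow> 'b::{real_normed_field, euclidean_space}) \<Rightarrow>
     ('a \<Rightarrow> 'b) \<Rightarrow> 'a \<Rightarrow> bool" where
  "singular_integral_exists K f x \<longleftrightarrow>
     (\<forall>\<epsilon>>0. set_integrable lebesgue {y. dist x y > \<epsilon>} (\<lambda>y. K x y * f y)) \<and>
     (\<exists>s. (truncated_integral K f x \<longlongrightarrow> s) (at_right 0))"

definition singular_integral ::
    "('a::euclidean_space \<Rightarrow> 'a \<Rightarrow> 'b::{real_normed_field, euclidean_space}) \<Rightarrow>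
     ('a \<Rightarrow> 'b) \<Rightarrow> 'a \<Rightarrow> 'b" where
  "singular_integral K f x = Lim (at_right 0) (truncated_integral K f x)"

definition bounded_into_itself :: "'f set \<Rightarrow> ('f \<Rightarrow> real) \<Rightarrow> ('f \<Rightarrow> 'f) \<Rightarrow> bool" where
  "bounded_into_itself X N T \<longleftrightarrow> (\<exists>C. \<forall>f\<in>X. T f \<in> X \<and> N (T f) \<le> C * N f)"

end

theory Submission
  imports Defs
begin

text \<open>
  Fix a ball of radius \<open>r\<close> around \<open>x\<close> and split \<open>f = f\<^sub>1 + f\<^sub>2\<close> with \<open>f\<^sub>1\<close> supported in the doubled
  ball.  The \<open>L\<^sup>p\<close> bound controls \<open>S f\<^sub>1\<close>.  On the ball, the size condition on the kernel bounds
  \<open>S f\<^sub>2\<close> by \<open>\<integral> |x - y|\<^sup>-\<^sup>n |f y| dy\<close> over the complement of the doubled ball, and a dyadic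
  decomposition with Hoelder's inequality turns this into the pointwise estimate
  \<open>M(S f; x, r)\<^bsup>1/p\<^esup> \<le> C \<Sum>\<^sub>k q\<^sup>k M(f; x, 2\<^bsup>k+1\<^esup> r)\<^bsup>1/p\<^esup>\<close> with \<open>q = 2\<^bsup>(l-n)/p\<^esup> < 1\<close>.
  Boundedness is immediate, and each vanishing property passes from the terms of this uniformly
  convergent series to its sum.  For \<open>(V\<^sup>*)\<close> one also uses that a ball is covered by finitely many
  unit balls, their number depending only on its radius.

  A Morrey function need not lie in \<open>L\<^sup>p\<close>; that \<open>S f\<close> exists almost everywhere and is measurable
  follows from the corresponding facts for the cut-offs of \<open>f\<close> to the balls around \<open>0\<close>.
\<close>

section \<open>Inequalities for real powers\<close>

text \<open>Below \<open>d\<close> the first summand suffices. Above it,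
  \<open>u = u powr (1 - p) * u powr p\<close>, and the exponent \<open>1 - p\<close> is not
  positive, so \<open>u\<close> may be lowered to \<open>d\<close> in the first factor. The
  threshold \<open>d\<close> stays free for later optimisation.\<close>

lemma le_add_powr:
  fixes u d p :: real
  assumes "0 \<le> u" "0 < d" "1 \<le> p"
  shows "u \<le> d + d powr (1 - p) * u powr p"
proof (cases "u \<le> d")
  case False
  have "u = u powr (1 - p) * u powr p"
    using False assms by (simp flip: powr_add)
  also have "\<dots> \<le> d powr (1 - p) * u powr p"
    using False assms by (intro mult_right_mono powr_mono2') auto
  finally show ?thesis
    using assms by linarith
qed (use assms in \<open>auto intro: add_increasing2\<close>)

lemma add_powr_le:
  fixes u v p :: real
  assumes "0 \<le> u" "0 \<le> v" "0 \<le> p"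
  shows "(u + v) powr p \<le> 2 powr p * (u powr p + v powr p)"
proof -
  have "(u + v) powr p \<le> (2 * max u v) powr p"
    using assms by (intro powr_mono2) auto
  also have "\<dots> = 2 powr p * max u v powr p"
    using assms by (simp add: powr_mult)
  also have "\<dots> \<le> 2 powr p * (u powr p + v powr p)"
    by (intro mult_left_mono) (auto simp: max_def)
  finally show ?thesis .
qed

text \<open>In terms of the p-th roots \<open>a\<close>, \<open>b\<close> this is
  \<open>a powr p + b powr p \<le> (a + b) powr p\<close>: split one factor off each power and bound
  the remaining \<open>p - 1\<close> factors by those of \<open>a + b\<close>. It separates the near
  and far contributions after taking roots.\<close>

lemma add_powr_inverse_le:
  fixes u v p :: real
  assumes "0 \<le> u" "0 \<le> v" "1 \<le> p"
  shows "(u + v) powr (1 / p) \<le> u powr (1 / p) + v powr (1 / p)"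
proof -
  define a b where "a = u powr (1 / p)" and "b = v powr (1 / p)"
  have ab: "0 \<le> a" "0 \<le> b" "u = a powr p" "v = b powr p"
    using assms by (auto simp: a_def b_def powr_powr)
  have *: "a powr p + b powr p \<le> (a + b) powr p"
  proof (cases "a + b = 0")
    case False
    then have pos: "0 < a + b" using ab by auto
    have le: "t powr p \<le> t * (a + b) powr (p - 1)" if "0 \<le> t" "t \<le> a + b" for t
    proof (cases "t = 0")
      case False
      then have "t powr p = t * t powr (p - 1)"
        using that by (simp add: powr_mult_base)
      also have "\<dots> \<le> t * (a + b) powr (p - 1)"
        using that assms by (intro mult_left_mono powr_mono2) auto
      finally show ?thesis .
    qed auto
    have "a powr p + b powr p \<le> (a + b) * (a + b) powr (p - 1)"
      using le[of a] le[of b] ab by (simp add: distrib_right)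
    also have "\<dots> = (a + b) powr p"
      using pos by (simp add: powr_mult_base)
    finally show ?thesis .
  qed (use ab assms in \<open>auto simp: add_nonneg_eq_0_iff\<close>)
  have "(u + v) powr (1 / p) \<le> ((a + b) powr p) powr (1 / p)"
    using * ab assms by (intro powr_mono2) auto
  also have "\<dots> = a + b"
    using ab assms by (simp add: powr_powr)
  finally show ?thesis by (simp add: a_def b_def)
qed

text \<open>Integrating the pointwise bound \<open>le_add_powr\<close> and optimising over \<open>d\<close> gives Hoelder's inequality
  up to the factor 2.\<close>
lemma set_integral_norm_le:
  fixes f :: "'a \<Rightarrow> 'b::{banach, second_countable_topology}"
  assumes p: "1 < p" and f: "f \<in> borel_measurable M" and A: "A \<in> fmeasurable M"
    and pos: "0 < measure M A"
    and int: "set_integrable M A (\<lambda>y. norm (f y) powr p)"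
  shows "set_integrable M A (\<lambda>y. norm (f y))"
    and "(LINT y:A|M. norm (f y)) \<le>
      2 * measure M A powr (1 - 1 / p) * (LINT y:A|M. norm (f y) powr p) powr (1 / p)"
proof -
  note [measurable] = f
  have [measurable]: "A \<in> sets M" using A by blast
  have const: "set_integrable M A (\<lambda>_. d)" for d :: real
    using A unfolding set_integrable_def fmeasurable_def by auto
  have dom: "set_integrable M A (\<lambda>y. d + d powr (1 - p) * norm (f y) powr p)" for d :: real
    using int const by (intro set_integral_add) auto
  show norm_int: "set_integrable M A (\<lambda>y. norm (f y))"
  proof (rule set_integrable_bound[OF dom[of 1]])
    show "AE x in M. x \<in> A \<longrightarrow> norm (norm (f x)) \<le> norm (1 + 1 powr (1 - p) * norm (f x) powr p)"
      using le_add_powr[of "norm (f _)" 1 p] p by (intro AE_I2) (smt (verit) norm_ge_zero real_norm_def)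
  qed (simp add: set_borel_measurable_def)
  define I m where "I = (LINT y:A|M. norm (f y) powr p)" and "m = measure M A"
  have I: "0 \<le> I"
    unfolding I_def set_lebesgue_integral_def by (intro integral_nonneg_AE) auto
  have bound: "(LINT y:A|M. norm (f y)) \<le> d * m + d powr (1 - p) * I" if "0 < d" for d
  proof -
    have "(LINT y:A|M. norm (f y)) \<le> (LINT y:A|M. d + d powr (1 - p) * norm (f y) powr p)"
      using norm_int dom le_add_powr[OF _ that, of _ p] p by (intro set_integral_mono) auto
    also have "\<dots> = d * m + d powr (1 - p) * I"
      using A const int unfolding I_def m_def fmeasurable_def
      by (subst set_integral_add) (auto simp: set_integral_const)
    finally show ?thesis .
  qed
  show "(LINT y:A|M. norm (f y)) \<le>
      2 * measure M A powr (1 - 1 / p) * (LINT y:A|M. norm (f y) powr p) powr (1 / p)"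
  proof (cases "I = 0")
    \<comment> \<open>The optimal \<open>d\<close> would be 0, which \<open>bound\<close> excludes;
      arbitrarily small positive \<open>d\<close> take its place.\<close>
    case True
    have "(LINT y:A|M. norm (f y)) \<le> 0 + e" if "0 < e" for e
      using bound[of "e / m"] that pos True by (simp add: m_def)
    then have "(LINT y:A|M. norm (f y)) \<le> 0"
      by (rule field_le_epsilon)
    then show ?thesis using True I_def by simp
  next
    case False
    \<comment> \<open>This \<open>d\<close> makes the two terms of \<open>bound\<close> equal, which
      is where the factor 2 comes from.\<close>
    define d where "d = (I / m) powr (1 / p)"
    have Ip: "0 < I" "0 < m" using False I pos by (auto simp: m_def)
    have "d * m = m powr (1 - 1 / p) * I powr (1 / p)"
      using Ip by (simp add: d_def powr_divide powr_diff)
    moreover have "d powr (1 - p) * I = m powr (1 - 1 / p) * I powr (1 / p)"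
    proof -
      have "d powr (1 - p) = (I / m) powr (1 / p - 1)"
        using p by (simp add: d_def powr_powr diff_divide_distrib)
      then show ?thesis
        using Ip by (simp add: powr_divide powr_diff)
    qed
    ultimately show ?thesis
      using bound[of d] Ip by (simp add: d_def I_def m_def)
  qed
qed

section \<open>Morrey means and dyadic sums\<close>

lemma locally_p_integrableD:
  assumes "locally_p_integrable p f"
  shows "f \<in> borel_measurable lebesgue"
    and "set_integrable lebesgue (ball x r) (\<lambda>y. norm (f y) powr p)"
proof -
  have "set_integrable lebesgue (cball x r) (\<lambda>y. norm (f y) powr p)"
    using assms by (auto simp: locally_p_integrable_def)
  then show "set_integrable lebesgue (ball x r) (\<lambda>y. norm (f y) powr p)"
    by (rule set_integrable_subset) auto
qed (use assms in \<open>simp add: locally_p_integrable_def\<close>)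

lemma morrey_spaceD:
  assumes "f \<in> morrey_space p l"
  shows "locally_p_integrable p f"
    and "0 < r \<Longrightarrow> morrey_mean p l f x r powr (1 / p) \<le> morrey_norm p l f"
proof -
  show "morrey_mean p l f x r powr (1 / p) \<le> morrey_norm p l f" if "0 < r"
  proof -
    have "(\<lambda>(x, r). morrey_mean p l f x r powr (1 / p)) (x, r) \<le> morrey_norm p l f"
      unfolding morrey_norm_def using assms that
      by (intro cSUP_upper) (auto simp: morrey_space_def)
    then show ?thesis by simp
  qed
qed (use assms in \<open>simp add: morrey_space_def\<close>)

lemma morrey_mean_nonneg: "0 \<le> morrey_mean p l f x r"
  unfolding morrey_mean_def set_lebesgue_integral_def by simp

lemma set_integral_eq_morrey_mean:
  "0 < r \<Longrightarrow> (LINT y:ball x r|lebesgue. norm (f y) powr p) = r powr l * morrey_mean p l f x r"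
  by (simp add: morrey_mean_def)

lemma morrey_mean_le_norm:
  assumes "f \<in> morrey_space p l" "1 < p" "0 < r"
  shows "morrey_mean p l f x r \<le> morrey_norm p l f powr p"
proof -
  have "morrey_mean p l f x r = (morrey_mean p l f x r powr (1 / p)) powr p"
    using assms(2) morrey_mean_nonneg[of p l f x r] by (simp add: powr_powr)
  also have "\<dots> \<le> morrey_norm p l f powr p"
    using morrey_spaceD(2)[OF assms(1,3)] assms(2) by (intro powr_mono2) auto
  finally show ?thesis .
qed

text \<open>The weight is the price of doubling the radius: Hoelder's inequality on a ball of radius
  \<rho> gives the factor \<rho> to the power n - (n-l)/p, and the kernel contributes \<rho> to the
  power -n.\<close>

definition dyadic_morrey_sum ::
    "real \<Rightarrow> real \<Rightarrow> ('a::euclidean_space \<Rightarrow> 'b::euclidean_space) \<Rightarrow> 'a \<Rightarrow> real \<Rightarrow> real" where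
  "dyadic_morrey_sum p l f x r =
     (\<Sum>k. (2 powr (- ((real DIM('a) - l) / p))) ^ k * morrey_mean p l f x (2 ^ (k + 1) * r) powr (1 / p))"

section \<open>Convergence and bounds for the dyadic series\<close>

lemma dyadic_ratio:
  assumes "1 < p" "l < n"
  shows "0 < 2 powr (- ((n - l) / p))" "2 powr (- ((n - l) / p)) < (1::real)"
  using assms by (auto simp: powr_less_one)

lemma dyadic_morrey_summable:
  fixes f :: "'a::euclidean_space \<Rightarrow> 'b::euclidean_space"
  assumes f: "f \<in> morrey_space p l" and p: "1 < p" and l: "l < real DIM('a)" and r: "0 < r"
  shows "summable (\<lambda>k. (2 powr (- ((real DIM('a) - l) / p))) ^ k * morrey_mean p l f x (2 ^ (k + 1) * r) powr (1 / p))"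
proof (rule summable_comparison_test)
  let ?q = "2 powr (- ((real DIM('a) - l) / p))"
  show "summable (\<lambda>k. ?q ^ k * morrey_norm p l f)"
    using dyadic_ratio[OF p l] by (intro summable_mult2 summable_geometric) simp
  show "\<exists>N. \<forall>k\<ge>N. norm (?q ^ k * morrey_mean p l f x (2 ^ (k + 1) * r) powr (1 / p)) \<le> ?q ^ k * morrey_norm p l f"
    using r morrey_spaceD(2)[OF f] by (intro exI[of _ 0]) (auto simp: abs_mult intro!: mult_mono)
qed

lemma dyadic_morrey_sum_nonneg:
  fixes f :: "'a::euclidean_space \<Rightarrow> 'b::euclidean_space"
  assumes f: "f \<in> morrey_space p l" and p: "1 < p" and l: "l < real DIM('a)" and r: "0 < r"
  shows "0 \<le> dyadic_morrey_sum p l f x r"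
  unfolding dyadic_morrey_sum_def
  by (rule suminf_nonneg[OF dyadic_morrey_summable[OF assms]]) simp

text \<open>The term \<open>k = 0\<close> lets the same series absorb the near part, which involves
  only the doubled ball.\<close>

lemma first_le_dyadic_morrey_sum:
  fixes f :: "'a::euclidean_space \<Rightarrow> 'b::euclidean_space"
  assumes f: "f \<in> morrey_space p l" and p: "1 < p" and l: "l < real DIM('a)" and r: "0 < r"
  shows "morrey_mean p l f x (2 * r) powr (1 / p) \<le> dyadic_morrey_sum p l f x r"
  using sum_le_suminf[OF dyadic_morrey_summable[OF assms], of "{0}" x]
  by (simp add: dyadic_morrey_sum_def)

text \<open>The first \<open>m\<close> terms are compared with a geometric series of size
  \<open>e\<close>, the rest with one of size \<open>q ^ m\<close> times the norm. Taking
  \<open>m = 0\<close> and \<open>e = 0\<close> gives a bound uniform in \<open>x\<close> and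
  \<open>r\<close>; large \<open>m\<close> serves the vanishing conditions.\<close>

lemma dyadic_morrey_sum_le:
  fixes f :: "'a::euclidean_space \<Rightarrow> 'b::euclidean_space" and x :: 'a
  assumes f: "f \<in> morrey_space p l" and p: "1 < p" and l: "l < real DIM('a)" and r: "0 < r"
    and M: "0 \<le> e" "\<And>k. k < m \<Longrightarrow> morrey_mean p l f x (2 ^ (k + 1) * r) powr (1 / p) \<le> e"
  defines "q \<equiv> 2 powr (- ((real DIM('a) - l) / p))"
  shows "dyadic_morrey_sum p l f x r \<le> (e + q ^ m * morrey_norm p l f) / (1 - q)"
proof -
  define a where "a k = morrey_mean p l f x (2 ^ (k + 1) * r) powr (1 / p)" for k
  have q: "0 < q" "q < 1" using dyadic_ratio[OF p l] by (auto simp: q_def)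
  have sm: "summable (\<lambda>k. q ^ k * a k)"
    using dyadic_morrey_summable[OF f p l r] by (simp add: a_def q_def)
  have geo: "summable (\<lambda>k. q ^ k * c)" for c
    using q by (intro summable_mult2 summable_geometric) simp
  have "dyadic_morrey_sum p l f x r = (\<Sum>k. q ^ (k + m) * a (k + m)) + (\<Sum>k<m. q ^ k * a k)"
    unfolding dyadic_morrey_sum_def q_def[symmetric] a_def[symmetric]
    by (rule suminf_split_initial_segment[OF sm])
  also have "(\<Sum>k. q ^ (k + m) * a (k + m)) \<le> (\<Sum>k. q ^ k * (q ^ m * morrey_norm p l f))"
  proof (rule suminf_le)
    show "q ^ (k + m) * a (k + m) \<le> q ^ k * (q ^ m * morrey_norm p l f)" for k
      using q r morrey_spaceD(2)[OF f, of "2 ^ (k + m + 1) * r" x]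
      by (simp add: power_add a_def mult_ac)
    show "summable (\<lambda>k. q ^ (k + m) * a (k + m))"
      using sm by (subst summable_iff_shift)
  qed (rule geo)
  also have "(\<Sum>k. q ^ k * (q ^ m * morrey_norm p l f)) = q ^ m * morrey_norm p l f / (1 - q)"
    using q by (subst suminf_mult2[symmetric]) (auto simp: suminf_geometric summable_geometric)
  also have "(\<Sum>k<m. q ^ k * a k) \<le> (\<Sum>k. q ^ k * e)"
  proof -
    have "(\<Sum>k<m. q ^ k * a k) \<le> (\<Sum>k<m. q ^ k * e)"
      using q M by (intro sum_mono mult_left_mono) (auto simp: a_def)
    also have "\<dots> \<le> (\<Sum>k. q ^ k * e)"
      using q M by (intro sum_le_suminf geo) auto
    finally show ?thesis .
  qed
  also have "(\<Sum>k. q ^ k * e) = e / (1 - q)"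
    using q by (subst suminf_mult2[symmetric]) (auto simp: suminf_geometric summable_geometric)
  finally show ?thesis
    by (simp add: add_divide_distrib)
qed

text \<open>Hoelder's inequality with the radius made explicit: the volume contributes the exponent
  n(1 - 1/p) and the Morrey normalisation l/p, which add up to n - (n-l)/p.\<close>

lemma set_integral_ball_norm_le:
  fixes f :: "'a::euclidean_space \<Rightarrow> 'b::euclidean_space"
  assumes f: "locally_p_integrable p f" and p: "1 < p" and r: "0 < r"
  shows "set_integrable lebesgue (ball x r) (\<lambda>y. norm (f y))"
    and "(LINT y:ball x r|lebesgue. norm (f y)) \<le>
      2 * measure lborel (ball (0::'a) 1) powr (1 - 1 / p) *
      (r powr (real DIM('a) - (real DIM('a) - l) / p) * morrey_mean p l f x r powr (1 / p))"
proof -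
  have m: "measure lebesgue (ball x r) = r powr real DIM('a) * measure lborel (ball (0::'a) 1)"
    using r content_ball_conv_unit_ball[of r x] by (simp add: powr_realpow)
  then have pos: "0 < measure lebesgue (ball x r)"
    using r by (simp add: content_ball_pos)
  note * = set_integral_norm_le[OF p locally_p_integrableD(1)[OF f] lmeasurable_ball pos
      locally_p_integrableD(2)[OF f]]
  show "set_integrable lebesgue (ball x r) (\<lambda>y. norm (f y))" by (rule *(1))
  have "(r powr real DIM('a)) powr (1 - 1 / p) * (r powr l) powr (1 / p) = r powr (real DIM('a) - (real DIM('a) - l) / p)"
    using p by (simp add: powr_powr powr_add[symmetric] field_simps)
  then have eq: "(r powr real DIM('a)) powr (1 - 1 / p) * ((r powr l) powr (1 / p) * b) =
      r powr (real DIM('a) - (real DIM('a) - l) / p) * b" for b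
    by (simp flip: mult.assoc)
  show "(LINT y:ball x r|lebesgue. norm (f y)) \<le>
      2 * measure lborel (ball (0::'a) 1) powr (1 - 1 / p) *
      (r powr (real DIM('a) - (real DIM('a) - l) / p) * morrey_mean p l f x r powr (1 / p))"
    using *(2) unfolding m set_integral_eq_morrey_mean[OF r, of x f p l]
    by (simp add: powr_mult morrey_mean_nonneg flip: eq) (simp add: mult_ac)
qed

text \<open>Where \<open>dist x y\<close> lies between \<open>\<rho> k / 2\<close> and
  \<open>\<rho> k\<close>, the kernel is at most \<open>(\<rho> k / 2) powr (- n)\<close>, with
  \<open>n\<close> the dimension. Hoelder's inequality on the ball of radius \<open>\<rho> k\<close>
  then bounds that piece by one term of the dyadic series.\<close>

lemma riesz_tail:
  fixes f :: "'a::euclidean_space \<Rightarrow> 'b::euclidean_space" and x :: 'a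
  assumes f: "f \<in> morrey_space p l" and p: "1 < p" and l: "l < real DIM('a)" and r: "0 < r"
  defines "h \<equiv> \<lambda>y. dist x y powr (- real DIM('a)) * norm (f y)"
  shows "set_integrable lebesgue (- ball x (2 * r)) h"
    and "(LINT y:- ball x (2 * r)|lebesgue. h y) \<le>
      2 ^ (DIM('a) + 1) * measure lborel (ball (0::'a) 1) powr (1 - 1 / p) *
      (r powr (- ((real DIM('a) - l) / p)) * dyadic_morrey_sum p l f x r)"
proof -
  let ?n = "DIM('a)"
  define s q w where "s = (real ?n - l) / p" and "q = 2 powr (- s)"
    and "w = measure lborel (ball (0::'a) 1) powr (1 - 1 / p)"
  \<comment> \<open>The shells start outside the ball of radius \<open>2 * r\<close>, so
    \<open>\<rho> k\<close> is the radius occurring in \<open>a (k + 1)\<close>, not in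
    \<open>a k\<close>.\<close>
  define \<rho> where "\<rho> k = 2 ^ (k + 2) * r" for k :: nat
  define a where "a k = morrey_mean p l f x (2 ^ (k + 1) * r) powr (1 / p)" for k
  \<comment> \<open>Whole balls instead of shells: only an upper bound is wanted, and Hoelder's
    inequality is available on balls.\<close>
  define T where "T k y = indicator (ball x (\<rho> k)) y * ((\<rho> k / 2) powr (- real ?n) * norm (f y))" for k y
  have lf: "locally_p_integrable p f" and [measurable]: "f \<in> borel_measurable lebesgue"
    using morrey_spaceD(1)[OF f] by (auto dest: locally_p_integrableD)
  have \<rho>: "0 < \<rho> k" for k using r by (simp add: \<rho>_def)
  have q: "0 < q" "q < 1" using dyadic_ratio[OF p l] by (auto simp: q_def s_def)
  have sm: "summable (\<lambda>k. q ^ k * a k)" and D: "dyadic_morrey_sum p l f x r = (\<Sum>k. q ^ k * a k)"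
    using dyadic_morrey_summable[OF f p l r] by (auto simp: a_def q_def s_def dyadic_morrey_sum_def)
  have sm1: "summable (\<lambda>k. q ^ (k + 1) * a (k + 1))"
    using sm by (subst summable_iff_shift)
  have hm [measurable]: "h \<in> borel_measurable lebesgue"
  proof -
    have "(\<lambda>y. dist x y powr (- real ?n)) \<in> borel_measurable lebesgue"
      by (intro measurable_completion) measurable
    then show ?thesis
      unfolding h_def by measurable
  qed
  have Tint: "integrable lebesgue (T k)" and Tle: "integral\<^sup>L lebesgue (T k) \<le>
      2 ^ (?n + 1) * w * (r powr (- s) * (q ^ (k + 1) * a (k + 1)))" for k
  proof -
    note * = set_integral_ball_norm_le[OF lf p \<rho>, of x k]
    have "integrable lebesgue (\<lambda>y. (\<rho> k / 2) powr (- real ?n) * (indicator (ball x (\<rho> k)) y *\<^sub>R norm (f y)))"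
      using *(1) unfolding set_integrable_def by (intro integrable_mult_right)
    then show "integrable lebesgue (T k)"
      by (simp add: T_def[abs_def] mult_ac)
    have "integral\<^sup>L lebesgue (T k) = (\<rho> k / 2) powr (- real ?n) * (LINT y:ball x (\<rho> k)|lebesgue. norm (f y))"
      unfolding set_lebesgue_integral_def by (subst integral_mult_right_zero[symmetric]) (simp add: T_def[abs_def] mult_ac)
    also have "\<dots> \<le> (\<rho> k / 2) powr (- real ?n) * (2 * w * (\<rho> k powr (real ?n - s) * a (k + 1)))"
      using *(2)[of l] by (intro mult_left_mono) (auto simp: w_def s_def a_def \<rho>_def)
    also have "(\<rho> k / 2) powr (- real ?n) = 2 ^ ?n * \<rho> k powr (- real ?n)"
      using \<rho>[of k] by (simp add: powr_divide powr_minus powr_realpow divide_simps)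
    also have "2 ^ ?n * \<rho> k powr (- real ?n) * (2 * w * (\<rho> k powr (real ?n - s) * a (k + 1)))
        = 2 ^ (?n + 1) * w * (\<rho> k powr (- s) * a (k + 1))"
      by (simp add: powr_diff powr_minus field_simps)
    also have "\<rho> k powr (- s) = q ^ (k + 2) * r powr (- s)"
    proof -
      have "(2 ^ m) powr (- s) = (2 powr (- s)) ^ m" for m :: nat
        by (simp add: powr_powr mult_ac flip: powr_realpow)
      then show ?thesis
        using r by (simp only: \<rho>_def q_def powr_mult)
    qed
    \<comment> \<open>One factor \<open>q < 1\<close> is given away so that the power matches the
      index of \<open>a\<close>.\<close>
    also have "q ^ (k + 2) * r powr (- s) * a (k + 1) \<le> r powr (- s) * (q ^ (k + 1) * a (k + 1))"
      using q by (simp add: a_def mult_ac mult_left_le_one_le mult_right_le_one_le)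
    finally show "integral\<^sup>L lebesgue (T k) \<le>
        2 ^ (?n + 1) * w * (r powr (- s) * (q ^ (k + 1) * a (k + 1)))"
      by (simp add: w_def)
  qed
  have T0: "0 \<le> T k y" for k y by (simp add: T_def)
  have ptw: "ennreal (indicator (- ball x (2 * r)) y * h y) \<le> (\<Sum>k. ennreal (T k y))" for y
  proof (cases "y \<in> ball x (2 * r)")
    case False
    \<comment> \<open>Minimality places \<open>y\<close> in the k-th shell: \<open>y\<close> is
      outside the ball of radius \<open>\<rho> (k - 1) = \<rho> k / 2\<close>, or, for
      \<open>k = 0\<close>, outside that of radius \<open>2 * r\<close>.\<close>
    define k where "k = (LEAST k. dist x y < \<rho> k)"
    have "\<exists>k. dist x y < \<rho> k"
    proof -
      obtain j where "dist x y / r < 2 ^ j"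
        using real_arch_pow[of 2 "dist x y / r"] by auto
      also have "(2::real) ^ j \<le> 2 ^ (j + 2)" by (intro power_increasing) auto
      finally show ?thesis using r by (auto simp: \<rho>_def field_simps)
    qed
    then have k: "dist x y < \<rho> k" unfolding k_def by (rule LeastI_ex)
    have lower: "\<rho> k / 2 \<le> dist x y"
    proof (cases k)
      case 0 then show ?thesis using False by (simp add: \<rho>_def)
    next
      case (Suc j)
      then have "\<not> dist x y < \<rho> j" using not_less_Least[of j "\<lambda>k. dist x y < \<rho> k"] by (simp add: k_def)
      then show ?thesis using Suc by (simp add: \<rho>_def not_less mult_ac)
    qed
    have "h y \<le> T k y"
      using k lower \<rho>[of k] by (auto simp: h_def T_def intro!: mult_right_mono powr_mono2')
    then have "ennreal (indicator (- ball x (2 * r)) y * h y) \<le> ennreal (T k y)"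
      using T0 by (auto simp: indicator_def intro!: ennreal_leI)
    also have "\<dots> \<le> (\<Sum>k. ennreal (T k y))"
      using sum_le_suminf[of "\<lambda>k. ennreal (T k y)" "{k}"] by simp
    finally show ?thesis .
  qed simp
  \<comment> \<open>In \<open>ennreal\<close> sum and integral may be exchanged before
    \<open>h\<close> is known to be integrable; integrability then follows from the finite
    bound.\<close>
  have "(\<integral>\<^sup>+y. ennreal (indicator (- ball x (2 * r)) y * h y) \<partial>lebesgue) \<le>
      (\<integral>\<^sup>+y. (\<Sum>k. ennreal (T k y)) \<partial>lebesgue)"
    by (intro nn_integral_mono ptw)
  also have "\<dots> = (\<Sum>k. \<integral>\<^sup>+y. ennreal (T k y) \<partial>lebesgue)"
    using Tint by (intro nn_integral_suminf) (auto dest: borel_measurable_integrable)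
  also have "\<dots> = (\<Sum>k. ennreal (integral\<^sup>L lebesgue (T k)))"
    using Tint T0 by (intro suminf_cong nn_integral_eq_integral) auto
  also have "\<dots> \<le> (\<Sum>k. ennreal (2 ^ (?n + 1) * w * (r powr (- s) * (q ^ (k + 1) * a (k + 1)))))"
    using Tle by (intro suminf_le ennreal_leI) auto
  also have "\<dots> = ennreal (\<Sum>k. 2 ^ (?n + 1) * w * (r powr (- s) * (q ^ (k + 1) * a (k + 1))))"
    using q by (intro suminf_ennreal2 summable_mult sm1) (auto simp: w_def a_def)
  also have "(\<Sum>k. 2 ^ (?n + 1) * w * (r powr (- s) * (q ^ (k + 1) * a (k + 1)))) =
      2 ^ (?n + 1) * w * (r powr (- s) * (\<Sum>k. q ^ (k + 1) * a (k + 1)))"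
    using sm1 by (subst suminf_mult suminf_mult[OF summable_mult], assumption)+ simp
  \<comment> \<open>Adding the nonnegative term of index 0 completes the shifted series to
    \<open>dyadic_morrey_sum\<close>.\<close>
  also have "\<dots> \<le> 2 ^ (?n + 1) * w * (r powr (- s) * (\<Sum>k. q ^ k * a k))"
  proof (intro mult_left_mono)
    show "(\<Sum>k. q ^ (k + 1) * a (k + 1)) \<le> (\<Sum>k. q ^ k * a k)"
      using suminf_split_initial_segment[OF sm, of 1] by (simp add: a_def)
  qed (auto simp: w_def)
  finally have le: "(\<integral>\<^sup>+y. ennreal (indicator (- ball x (2 * r)) y * h y) \<partial>lebesgue) \<le>
      ennreal (2 ^ (?n + 1) * w * (r powr (- s) * (\<Sum>k. q ^ k * a k)))"
    by (simp add: ennreal_leI)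
  have int: "integrable lebesgue (\<lambda>y. indicator (- ball x (2 * r)) y * h y)"
  proof (rule integrableI_nonneg)
    show "(\<lambda>y. indicator (- ball x (2 * r)) y * h y) \<in> borel_measurable lebesgue"
      by (intro borel_measurable_times borel_measurable_indicator hm) auto
    show "(\<integral>\<^sup>+y. ennreal (indicator (- ball x (2 * r)) y * h y) \<partial>lebesgue) < \<infinity>"
      using le by (rule le_less_trans) simp
  qed (simp add: h_def)
  then show "set_integrable lebesgue (- ball x (2 * r)) h"
    by (simp add: set_integrable_def)
  have "(\<integral>y. indicator (- ball x (2 * r)) y * h y \<partial>lebesgue) \<le>
      2 ^ (?n + 1) * w * (r powr (- s) * (\<Sum>k. q ^ k * a k))"
  proof -
    have nn: "0 \<le> 2 ^ (?n + 1) * w * (r powr (- s) * (\<Sum>k. q ^ k * a k))"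
      using q by (intro mult_nonneg_nonneg suminf_nonneg sm) (auto simp: w_def a_def)
    have "ennreal (\<integral>y. indicator (- ball x (2 * r)) y * h y \<partial>lebesgue) \<le>
        ennreal (2 ^ (?n + 1) * w * (r powr (- s) * (\<Sum>k. q ^ k * a k)))"
      using le by (subst nn_integral_eq_integral[OF int, symmetric]) (auto simp: h_def)
    then show ?thesis
      using nn by (simp only: ennreal_le_iff)
  qed
  then show "(LINT y:- ball x (2 * r)|lebesgue. h y) \<le>
      2 ^ (DIM('a) + 1) * measure lborel (ball (0::'a) 1) powr (1 - 1 / p) *
      (r powr (- ((real DIM('a) - l) / p)) * dyadic_morrey_sum p l f x r)"
    by (simp add: set_lebesgue_integral_def w_def s_def D)
qed

section \<open>Singular integrals on Morrey spaces\<close>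

definition cutoff :: "'a set \<Rightarrow> ('a \<Rightarrow> 'b::real_vector) \<Rightarrow> 'a \<Rightarrow> 'b" where
  "cutoff A f y = indicator A y *\<^sub>R f y"

lemma norm_cutoff_powr:
  "norm (cutoff A f y) powr p = indicator A y *\<^sub>R (norm (f y) powr p)"
  by (auto simp: cutoff_def indicator_def)

lemma cutoff_in_Lp_space:
  assumes "locally_p_integrable p f"
  shows "cutoff (ball x r) f \<in> Lp_space p"
proof -
  have [measurable]: "f \<in> borel_measurable lebesgue"
    using assms by (rule locally_p_integrableD)
  have "cutoff (ball x r) f \<in> borel_measurable lebesgue"
    unfolding cutoff_def[abs_def] by (intro borel_measurable_scaleR borel_measurable_indicator) auto
  then show ?thesis
    using locally_p_integrableD(2)[OF assms, of x r]
    by (simp add: Lp_space_def norm_cutoff_powr set_integrable_def)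
qed

lemma Lp_norm_nonneg: "0 \<le> Lp_norm p f"
  by (simp add: Lp_norm_def)

lemma truncated_integral_diff:
  assumes "set_integrable lebesgue {y. dist x y > \<epsilon>} (\<lambda>y. K x y * f y)"
    and "set_integrable lebesgue {y. dist x y > \<epsilon>} (\<lambda>y. K x y * g y)"
  shows "truncated_integral K f x \<epsilon> - truncated_integral K g x \<epsilon> =
    (LINT y:{y. dist x y > \<epsilon>}|lebesgue. K x y * (f y - g y))"
  unfolding truncated_integral_def set_integral_diff(2)[OF assms, symmetric] by (simp add: right_diff_distrib)

lemma singular_integral_tendsto:
  assumes "singular_integral_exists K f x"
  shows "(truncated_integral K f x \<longlongrightarrow> singular_integral K f x) (at_right 0)"
proof -
  obtain s where s: "(truncated_integral K f x \<longlongrightarrow> s) (at_right 0)"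
    using assms by (auto simp: singular_integral_exists_def)
  moreover have "singular_integral K f x = s"
    unfolding singular_integral_def by (rule tendsto_Lim[OF _ s]) simp
  ultimately show ?thesis by simp
qed

section \<open>The operator on Morrey functions: existence, far part, measurability, local
  estimate\<close>

locale bounded_singular_integral =
  fixes K :: "'a::euclidean_space \<Rightarrow> 'a \<Rightarrow> 'b::{real_normed_field, euclidean_space}"
    and p l c :: real
  assumes p: "1 < p" and l: "l < real DIM('a)" and c: "0 < c"
    and exists_Lp: "\<And>f. f \<in> Lp_space p \<Longrightarrow> AE x in lebesgue. singular_integral_exists K f x"
    and bounded_Lp: "bounded_into_itself (Lp_space p) (Lp_norm p) (singular_integral K)"
    and kernel_le: "\<And>x y. x \<noteq> y \<Longrightarrow> norm (K x y) \<le> c * dist x y powr (- real DIM('a))"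
begin

text \<open>Off one null set the singular integrals of all the countably many cut-offs
  \<open>g M\<close> exist. If the unit ball around \<open>x\<close> lies in the ball of radius
  \<open>M\<close> around 0, the truncated integrals of \<open>f\<close> and \<open>g M\<close>
  differ by a constant for \<epsilon> < 1, so both converge.\<close>

lemma exists_morrey:
  assumes f: "f \<in> morrey_space p l"
  shows "AE x in lebesgue. singular_integral_exists K f x"
proof -
  define g where "g M = cutoff (ball 0 (real M)) f" for M
  have "AE x in lebesgue. \<forall>M. singular_integral_exists K (g M) x"
    unfolding AE_all_countable g_def
    using cutoff_in_Lp_space[OF morrey_spaceD(1)[OF f]] exists_Lp by blast
  then show ?thesis
  proof eventually_elim
    fix x assume ex: "\<forall>M. singular_integral_exists K (g M) x"
    have gint: "set_integrable lebesgue {y. dist x y > \<epsilon>} (\<lambda>y. K x y * g M y)" if "0 < \<epsilon>" for \<epsilon> M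
      using ex that by (auto simp: singular_integral_exists_def)
    have sets: "{y. dist x y > \<epsilon>} \<in> sets lebesgue" for \<epsilon>
      by (intro sets_completionI_sets) (simp, measurable)
    have fint: "set_integrable lebesgue {y. dist x y > \<epsilon>} (\<lambda>y. K x y * f y)" if \<epsilon>: "0 < \<epsilon>" for \<epsilon>
    proof (rule set_integrable_bound)
      \<comment> \<open>\<open>riesz_tail\<close> removes the doubled ball, hence the radius
        \<open>\<epsilon> / 2\<close>.\<close>
      have "set_integrable lebesgue (- ball x (2 * (\<epsilon> / 2))) (\<lambda>y. c * (dist x y powr (- real DIM('a)) * norm (f y)))"
        using riesz_tail(1)[OF f p l, of "\<epsilon> / 2" x] \<epsilon> by (intro set_integrable_mult_right) auto
      then show "set_integrable lebesgue {y. dist x y > \<epsilon>} (\<lambda>y. c * (dist x y powr (- real DIM('a)) * norm (f y)))"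
        by (rule set_integrable_subset) (use sets in auto)
      show "set_borel_measurable lebesgue {y. dist x y > \<epsilon>} (\<lambda>y. K x y * f y)"
        unfolding set_borel_measurable_def
      \<comment> \<open>The integrands with \<open>g M\<close> are measurable because they are
        integrable, and at each \<open>y\<close> they equal the one with \<open>f\<close> once
        \<open>M\<close> exceeds \<open>norm y\<close>.\<close>
      proof (rule borel_measurable_LIMSEQ_metric)
        show "(\<lambda>y. indicat_real {y. dist x y > \<epsilon>} y *\<^sub>R (K x y * g M y)) \<in> borel_measurable lebesgue" for M
          using gint[OF \<epsilon>, of M] by (auto simp: set_integrable_def)
        show "(\<lambda>M. indicat_real {y. dist x y > \<epsilon>} y *\<^sub>R (K x y * g M y)) \<longlonglongrightarrow>
            indicat_real {y. dist x y > \<epsilon>} y *\<^sub>R (K x y * f y)" for y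
        proof (rule tendsto_eventually)
          have "\<forall>\<^sub>F M in sequentially. norm y < real M"
            using filterlim_real_sequentially by (simp add: filterlim_at_top_dense)
          then show "\<forall>\<^sub>F M in sequentially. indicat_real {y. dist x y > \<epsilon>} y *\<^sub>R (K x y * g M y) =
              indicat_real {y. dist x y > \<epsilon>} y *\<^sub>R (K x y * f y)"
            by eventually_elim (simp add: g_def cutoff_def)
        qed
      qed
      show "AE y in lebesgue. y \<in> {y. dist x y > \<epsilon>} \<longrightarrow>
          norm (K x y * f y) \<le> norm (c * (dist x y powr (- real DIM('a)) * norm (f y)))"
      proof (intro AE_I2 impI)
        fix y assume "y \<in> {y. dist x y > \<epsilon>}"
        then have "norm (K x y) \<le> c * dist x y powr (- real DIM('a))"
          using \<epsilon> by (intro kernel_le) auto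
        then have "norm (K x y) * norm (f y) \<le> c * dist x y powr (- real DIM('a)) * norm (f y)"
          by (rule mult_right_mono) simp
        then show "norm (K x y * f y) \<le> norm (c * (dist x y powr (- real DIM('a)) * norm (f y)))"
          using c by (simp add: norm_mult abs_mult mult.assoc)
      qed
    qed
    obtain M :: nat where M: "norm x + 1 < real M"
      using reals_Archimedean2 by blast
    \<comment> \<open>The choice of \<open>M\<close> makes \<open>f - g M\<close> vanish within
      distance 1 of \<open>x\<close>, so lowering the truncation radius below 1 does not change this
      integral.\<close>
    define d where "d = (LINT y:{y. dist x y > 1}|lebesgue. K x y * (f y - g M y))"
    have "\<forall>\<^sub>F \<epsilon> in at_right 0. truncated_integral K (g M) x \<epsilon> + d = truncated_integral K f x \<epsilon>"
    proof -
      have "truncated_integral K (g M) x \<epsilon> + d = truncated_integral K f x \<epsilon>" if \<epsilon>: "0 < \<epsilon>" "\<epsilon> < 1" for \<epsilon>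
      proof -
        have "f y - g M y = 0" if "dist x y \<le> 1" for y
        proof -
          have "norm y < real M"
            using M that norm_triangle_ineq2[of y x] by (simp add: dist_norm norm_minus_commute)
          then show ?thesis by (simp add: g_def cutoff_def)
        qed
        then have "d = (LINT y:{y. dist x y > \<epsilon>}|lebesgue. K x y * (f y - g M y))"
          unfolding d_def set_lebesgue_integral_def using \<epsilon>
          by (intro Bochner_Integration.integral_cong refl) (auto simp: indicator_def not_less)
        then show ?thesis
          using truncated_integral_diff[where K=K and x=x, OF fint[OF \<epsilon>(1)] gint[OF \<epsilon>(1), of M]] by (simp add: algebra_simps)
      qed
      then show ?thesis
        by (intro eventually_at_rightI[of 0 1]) auto
    qed
    moreover have "((\<lambda>\<epsilon>. truncated_integral K (g M) x \<epsilon> + d) \<longlongrightarrow> singular_integral K (g M) x + d) (at_right 0)"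
      using ex by (intro tendsto_intros singular_integral_tendsto) auto
    ultimately have "(truncated_integral K f x \<longlongrightarrow> singular_integral K (g M) x + d) (at_right 0)"
      by (rule Lim_transform_eventually[rotated])
    then show "singular_integral_exists K f x"
      using fint unfolding singular_integral_exists_def by blast
  qed
qed

text \<open>The difference of the truncated integrals involves only \<open>y\<close> outside the
  doubled ball, where passing from \<open>dist x y\<close> to \<open>dist x0 y\<close> costs a
  factor 2 to the dimension. The resulting bound does not depend on \<epsilon> and passes to the
  limit.\<close>

lemma far_part_le:
  assumes f: "f \<in> morrey_space p l" and r: "0 < r" and x: "x \<in> ball x0 r"
    and ex: "singular_integral_exists K f x" "singular_integral_exists K (cutoff (ball x0 (2 * r)) f) x"
  shows "norm (singular_integral K f x - singular_integral K (cutoff (ball x0 (2 * r)) f) x) \<le>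
    c * 2 ^ DIM('a) * (LINT y:- ball x0 (2 * r)|lebesgue. dist x0 y powr (- real DIM('a)) * norm (f y))"
proof -
  define g where "g = cutoff (ball x0 (2 * r)) f"
  define h where "h y = indicat_real (- ball x0 (2 * r)) y * (dist x0 y powr (- real DIM('a)) * norm (f y))" for y
  have h: "integrable lebesgue (\<lambda>y. c * 2 ^ DIM('a) * h y)"
    using riesz_tail(1)[OF f p l r, of x0] unfolding h_def set_integrable_def
    by (intro integrable_mult_right) auto
  have ptw: "norm (indicat_real {y. dist x y > \<epsilon>} y *\<^sub>R (K x y * (f y - g y))) \<le> c * 2 ^ DIM('a) * h y" for \<epsilon> y
  proof (cases "y \<in> ball x0 (2 * r)")
    case False
    \<comment> \<open>\<open>dist x0 x < r \<le> dist x0 y / 2\<close>, so the triangle inequality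
      leaves at least the other half.\<close>
    have near: "dist x0 y / 2 \<le> dist x y"
      using False x dist_triangle[of x0 y x] by simp
    have pos: "0 < dist x0 y" using False r by auto
    then have "x \<noteq> y" using near by auto
    then have "norm (K x y) \<le> c * dist x y powr (- real DIM('a))" by (rule kernel_le)
    also have "\<dots> \<le> c * (dist x0 y / 2) powr (- real DIM('a))"
      using c near pos by (intro mult_left_mono powr_mono2') auto
    also have "\<dots> = c * 2 ^ DIM('a) * dist x0 y powr (- real DIM('a))"
      using pos by (simp add: powr_divide powr_minus powr_realpow divide_simps)
    finally have "norm (K x y) * norm (f y) \<le> c * 2 ^ DIM('a) * dist x0 y powr (- real DIM('a)) * norm (f y)"
      by (intro mult_right_mono) auto
    then show ?thesis
      using False c by (auto simp: g_def cutoff_def h_def norm_mult mult.assoc indicator_def)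
  qed (simp add: g_def cutoff_def h_def)
  have bound: "norm (truncated_integral K f x \<epsilon> - truncated_integral K g x \<epsilon>) \<le>
      integral\<^sup>L lebesgue (\<lambda>y. c * 2 ^ DIM('a) * h y)" if \<epsilon>: "0 < \<epsilon>" for \<epsilon>
  proof -
    have int: "set_integrable lebesgue {y. dist x y > \<epsilon>} (\<lambda>y. K x y * f y)"
        "set_integrable lebesgue {y. dist x y > \<epsilon>} (\<lambda>y. K x y * g y)"
      using ex \<epsilon> by (auto simp: g_def singular_integral_exists_def)
    then have "set_integrable lebesgue {y. dist x y > \<epsilon>} (\<lambda>y. K x y * (f y - g y))"
      unfolding right_diff_distrib by (rule set_integral_diff)
    then have "norm (LINT y:{y. dist x y > \<epsilon>}|lebesgue. K x y * (f y - g y)) \<le>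
        (\<integral>y. norm (indicat_real {y. dist x y > \<epsilon>} y *\<^sub>R (K x y * (f y - g y))) \<partial>lebesgue)"
      and "integrable lebesgue (\<lambda>y. norm (indicat_real {y. dist x y > \<epsilon>} y *\<^sub>R (K x y * (f y - g y))))"
      unfolding set_lebesgue_integral_def set_integrable_def
      by (auto intro!: integral_norm_bound simp del: norm_scaleR)
    moreover from this(2) have "(\<integral>y. norm (indicat_real {y. dist x y > \<epsilon>} y *\<^sub>R (K x y * (f y - g y))) \<partial>lebesgue)
        \<le> integral\<^sup>L lebesgue (\<lambda>y. c * 2 ^ DIM('a) * h y)"
      using h ptw by (intro integral_mono) auto
    ultimately show ?thesis
      unfolding truncated_integral_diff[where K=K and x=x, OF int] by linarith
  qed
  have "((\<lambda>\<epsilon>. norm (truncated_integral K f x \<epsilon> - truncated_integral K g x \<epsilon>)) \<longlongrightarrow>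
      norm (singular_integral K f x - singular_integral K g x)) (at_right 0)"
    using ex by (intro tendsto_intros singular_integral_tendsto) (auto simp: g_def)
  then have "norm (singular_integral K f x - singular_integral K g x) \<le>
      integral\<^sup>L lebesgue (\<lambda>y. c * 2 ^ DIM('a) * h y)"
  proof (rule tendsto_upperbound)
    show "\<forall>\<^sub>F \<epsilon> in at_right 0. norm (truncated_integral K f x \<epsilon> - truncated_integral K g x \<epsilon>) \<le>
        integral\<^sup>L lebesgue (\<lambda>y. c * 2 ^ DIM('a) * h y)"
      using bound by (intro eventually_at_rightI[of 0 1]) auto
  qed simp
  then show ?thesis
    by (simp add: g_def h_def set_lebesgue_integral_def)
qed

text \<open>The cost of moving the kernel's centre to \<open>x0\<close>, times the constant of
  \<open>riesz_tail\<close>.\<close>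

definition far_const :: real where
  "far_const = c * 2 ^ DIM('a) * (2 ^ (DIM('a) + 1) * measure lborel (ball (0::'a) 1) powr (1 - 1 / p))"

lemma far_const_nonneg: "0 \<le> far_const"
  using c by (simp add: far_const_def)

text \<open>The exceptional null set may depend on the ball, since the cut-off does; later arguments
  use one ball or countably many.\<close>

lemma AE_far_part_le:
  assumes f: "f \<in> morrey_space p l" and r: "0 < r"
  shows "AE x in lebesgue. x \<in> ball x0 r \<longrightarrow>
    norm (singular_integral K f x - singular_integral K (cutoff (ball x0 (2 * r)) f) x) \<le>
    far_const * (r powr (- ((real DIM('a) - l) / p)) * dyadic_morrey_sum p l f x0 r)"
  using exists_morrey[OF f] exists_Lp[OF cutoff_in_Lp_space[OF morrey_spaceD(1)[OF f], of x0 "2 * r"]]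
proof eventually_elim
  case (elim x)
  show ?case
  proof
    assume "x \<in> ball x0 r"
    note far_part_le[OF f r this elim]
    also have "c * 2 ^ DIM('a) * (LINT y:- ball x0 (2 * r)|lebesgue. dist x0 y powr (- real DIM('a)) * norm (f y)) \<le>
        c * 2 ^ DIM('a) * (2 ^ (DIM('a) + 1) * measure lborel (ball (0::'a) 1) powr (1 - 1 / p) *
          (r powr (- ((real DIM('a) - l) / p)) * dyadic_morrey_sum p l f x0 r))"
      using c by (intro mult_left_mono riesz_tail(2)[OF f p l r]) auto
    finally show "norm (singular_integral K f x - singular_integral K (cutoff (ball x0 (2 * r)) f) x) \<le>
        far_const * (r powr (- ((real DIM('a) - l) / p)) * dyadic_morrey_sum p l f x0 r)"
      by (simp add: far_const_def mult.assoc)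
  qed
qed

text \<open>On growing balls around 0 the far part decays like the radius to the power
  \<open>- s\<close>, so the measurable singular integrals of the cut-offs converge almost
  everywhere to that of \<open>f\<close>.\<close>

lemma singular_integral_measurable:
  assumes f: "f \<in> morrey_space p l"
  shows "singular_integral K f \<in> borel_measurable lebesgue"
proof -
  \<comment> \<open>\<open>Suc\<close> keeps the radius positive at \<open>M = 0\<close>; the factor
    2 matches the cut-off in \<open>AE_far_part_le\<close>.\<close>
  define g where "g M = singular_integral K (cutoff (ball 0 (2 * real (Suc M))) f)" for M
  define s where "s = (real DIM('a) - l) / p"
  define N where "N = morrey_norm p l f / (1 - 2 powr (- s))"
  have s: "0 < s" using p l by (simp add: s_def)
  have g: "g M \<in> borel_measurable lebesgue" for M
    using bounded_Lp cutoff_in_Lp_space[OF morrey_spaceD(1)[OF f]]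
    by (auto simp: g_def bounded_into_itself_def Lp_space_def)
  have "AE x in lebesgue. \<forall>M. x \<in> ball 0 (real (Suc M)) \<longrightarrow>
      norm (singular_integral K f x - g M x) \<le>
      far_const * (real (Suc M) powr (- s) * dyadic_morrey_sum p l f 0 (real (Suc M)))"
    unfolding AE_all_countable g_def s_def by (intro allI AE_far_part_le f) simp
  then have "AE x in lebesgue. lim (\<lambda>M. g M x) = singular_integral K f x"
  proof eventually_elim
    case (elim x)
    have "(\<lambda>M. g M x - singular_integral K f x) \<longlonglongrightarrow> 0"
    proof (rule Lim_null_comparison)
      have "\<forall>\<^sub>F M in sequentially. norm x < real M"
        using filterlim_real_sequentially by (simp add: filterlim_at_top_dense)
      then show "\<forall>\<^sub>F M in sequentially. norm (g M x - singular_integral K f x) \<le>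
          far_const * (real (Suc M) powr (- s) * N)"
      proof eventually_elim
        case (elim M)
        have "norm (singular_integral K f x - g M x) \<le>
          far_const * (real (Suc M) powr (- s) * dyadic_morrey_sum p l f 0 (real (Suc M)))"
          using \<open>\<forall>M. x \<in> ball 0 (real (Suc M)) \<longrightarrow> _ M\<close> elim by simp
        also have "\<dots> \<le> far_const * (real (Suc M) powr (- s) * N)"
          using dyadic_morrey_sum_le[OF f p l, of "real (Suc M)" 0 0 0]
          by (intro mult_left_mono far_const_nonneg) (auto simp: N_def s_def)
        finally show ?case by (simp add: norm_minus_commute)
      qed
      have "filterlim (\<lambda>M. real (Suc M)) at_top sequentially"
        using filterlim_real_sequentially by (simp only: filterlim_sequentially_Suc)
      then have "(\<lambda>M. real (Suc M) powr (- s)) \<longlonglongrightarrow> 0"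
        using s by (intro tendsto_neg_powr) auto
      then show "(\<lambda>M. far_const * (real (Suc M) powr (- s) * N)) \<longlonglongrightarrow> 0"
        by (intro tendsto_mult_right_zero tendsto_mult_left_zero)
    qed
    then show ?case
      by (intro limI) (simp only: LIM_zero_iff)
  qed
  moreover have "(\<lambda>x. lim (\<lambda>M. g M x)) \<in> borel_measurable lebesgue"
    using g by (rule borel_measurable_lim_metric)
  ultimately show ?thesis
    \<comment> \<open>Completeness of Lebesgue measure carries measurability across almost
      everywhere equality.\<close>
    by (rule borel_measurable_AE[rotated])
qed

lemma singular_integral_powr_le:
  "\<exists>C\<ge>0. \<forall>f\<in>Lp_space p. integrable lebesgue (\<lambda>x. norm (singular_integral K f x) powr p) \<and>
     (LINT x|lebesgue. norm (singular_integral K f x) powr p) \<le>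
       C powr p * (LINT x|lebesgue. norm (f x) powr p)"
proof -
  obtain C where C: "\<And>f. f \<in> Lp_space p \<Longrightarrow> singular_integral K f \<in> Lp_space p"
      "\<And>f. f \<in> Lp_space p \<Longrightarrow> Lp_norm p (singular_integral K f) \<le> C * Lp_norm p f"
    using bounded_Lp by (auto simp: bounded_into_itself_def)
  show ?thesis
  \<comment> \<open>The constant in \<open>bounded_into_itself\<close> carries no sign.\<close>
  proof (intro exI[of _ "\<bar>C\<bar>"] conjI ballI)
    show "0 \<le> \<bar>C\<bar>" by simp
    fix f :: "'a \<Rightarrow> 'b" assume f: "f \<in> Lp_space p"
    show "integrable lebesgue (\<lambda>x. norm (singular_integral K f x) powr p)"
      using C(1)[OF f] by (simp add: Lp_space_def)
    have norm_powr: "Lp_norm p g powr p = (LINT x|lebesgue. norm (g x) powr p)" for g :: "'a \<Rightarrow> 'b"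
      using p by (simp add: Lp_norm_def powr_powr)
    have "Lp_norm p (singular_integral K f) powr p \<le> (\<bar>C\<bar> * Lp_norm p f) powr p"
    proof (intro powr_mono2)
      show "Lp_norm p (singular_integral K f) \<le> \<bar>C\<bar> * Lp_norm p f"
        using C(2)[OF f] by (rule order_trans) (simp add: mult_right_mono Lp_norm_nonneg)
    qed (use p in \<open>simp_all add: Lp_norm_nonneg\<close>)
    then show "(LINT x|lebesgue. norm (singular_integral K f x) powr p) \<le>
       \<bar>C\<bar> powr p * (LINT x|lebesgue. norm (f x) powr p)"
      unfolding norm_powr[symmetric] by (simp add: powr_mult Lp_norm_nonneg)
  qed
qed

lemma singular_integral_local:
  "\<exists>C\<ge>0. \<forall>f\<in>morrey_space p l. \<forall>x. \<forall>r>0.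
     set_integrable lebesgue (ball x r) (\<lambda>y. norm (singular_integral K f y) powr p) \<and>
     morrey_mean p l (singular_integral K f) x r powr (1 / p) \<le> C * dyadic_morrey_sum p l f x r"
proof -
  obtain C0 where C0: "0 \<le> C0"
    "\<And>f. f \<in> Lp_space p \<Longrightarrow> integrable lebesgue (\<lambda>x. norm (singular_integral K f x) powr p)"
    "\<And>f. f \<in> Lp_space p \<Longrightarrow> (LINT x|lebesgue. norm (singular_integral K f x) powr p) \<le>
       C0 powr p * (LINT x|lebesgue. norm (f x) powr p)"
    using singular_integral_powr_le by blast
  define w where "w = measure lborel (ball (0::'a) 1)"
  define s where "s = (real DIM('a) - l) / p"
  \<comment> \<open>The leading 2 is the root of the factor in \<open>add_powr_le\<close>,
    \<open>2 powr (l / p)\<close> comes from normalising over radius \<open>2 * r\<close> instead of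
    \<open>r\<close>, and \<open>w powr (1 / p)\<close> from the volume of the ball.\<close>
  define C where "C = 2 * (C0 * 2 powr (l / p) + far_const * w powr (1 / p))"
  have main: "set_integrable lebesgue (ball x r) (\<lambda>y. norm (singular_integral K f y) powr p) \<and>
      morrey_mean p l (singular_integral K f) x r powr (1 / p) \<le> C * dyadic_morrey_sum p l f x r"
    if f: "f \<in> morrey_space p l" and r: "0 < r" for f x r
  proof -
    let ?D = "dyadic_morrey_sum p l f x r"
    define g where "g = cutoff (ball x (2 * r)) f"
    define E where "E = far_const * (r powr (- s) * ?D)"
    have D: "0 \<le> ?D" by (rule dyadic_morrey_sum_nonneg[OF f p l r])
    have E: "0 \<le> E" using D far_const_nonneg by (simp add: E_def)
    have g: "g \<in> Lp_space p"
      unfolding g_def by (rule cutoff_in_Lp_space[OF morrey_spaceD(1)[OF f]])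
    note [measurable] = singular_integral_measurable[OF f]
    have Sg: "set_integrable lebesgue (ball x r) (\<lambda>y. norm (singular_integral K g y) powr p)"
      unfolding set_integrable_def by (intro integrable_mult_indicator C0(2)[OF g]) simp
    have const: "set_integrable lebesgue (ball x r) (\<lambda>_. E powr p)"
      using lmeasurable_ball[of x r] unfolding set_integrable_def fmeasurable_def by auto
    have dom: "set_integrable lebesgue (ball x r) (\<lambda>y. 2 powr p * (norm (singular_integral K g y) powr p + E powr p))"
      using Sg const by (intro set_integrable_mult_right set_integral_add)
    have ptw: "AE y in lebesgue. y \<in> ball x r \<longrightarrow> norm (singular_integral K f y) powr p \<le>
        2 powr p * (norm (singular_integral K g y) powr p + E powr p)"
      using AE_far_part_le[OF f r, of x]
    proof eventually_elim
      case (elim y)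
      show ?case
      proof
        assume "y \<in> ball x r"
        then have "norm (singular_integral K f y - singular_integral K g y) \<le> E"
          using elim by (simp add: g_def E_def s_def)
        then have "norm (singular_integral K f y) \<le> norm (singular_integral K g y) + E"
          using norm_triangle_ineq2[of "singular_integral K f y" "singular_integral K g y"] by linarith
        then have "norm (singular_integral K f y) powr p \<le> (norm (singular_integral K g y) + E) powr p"
          using p by (intro powr_mono2) auto
        also have "\<dots> \<le> 2 powr p * (norm (singular_integral K g y) powr p + E powr p)"
          using p E by (intro add_powr_le) auto
        finally show "norm (singular_integral K f y) powr p \<le>
          2 powr p * (norm (singular_integral K g y) powr p + E powr p)" .
      qed
    qed
    have Sf: "set_integrable lebesgue (ball x r) (\<lambda>y. norm (singular_integral K f y) powr p)"
    proof (rule set_integrable_bound[OF dom])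
      show "set_borel_measurable lebesgue (ball x r) (\<lambda>y. norm (singular_integral K f y) powr p)"
        unfolding set_borel_measurable_def
        by (intro borel_measurable_scaleR borel_measurable_indicator) (simp, measurable)
      show "AE y in lebesgue. y \<in> ball x r \<longrightarrow> norm (norm (singular_integral K f y) powr p) \<le>
        norm (2 powr p * (norm (singular_integral K g y) powr p + E powr p))"
        using ptw by eventually_elim simp
    qed
    have m: "measure lebesgue (ball x r) = r powr real DIM('a) * w"
      using r content_ball_conv_unit_ball[of r x] by (simp add: powr_realpow w_def)
    have "(LINT y:ball x r|lebesgue. norm (singular_integral K f y) powr p) \<le>
        (LINT y:ball x r|lebesgue. 2 powr p * (norm (singular_integral K g y) powr p + E powr p))"
      by (rule set_integral_mono_AE[OF Sf dom ptw])
    also have "\<dots> = 2 powr p * ((LINT y:ball x r|lebesgue. norm (singular_integral K g y) powr p)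
        + r powr real DIM('a) * w * E powr p)"
      using lmeasurable_ball[of x r] Sg const
      by (simp add: set_integral_add set_integral_const m fmeasurable_def)
    also have "(LINT y:ball x r|lebesgue. norm (singular_integral K g y) powr p) \<le>
        (LINT y|lebesgue. norm (singular_integral K g y) powr p)"
      using Sg C0(2)[OF g] unfolding set_lebesgue_integral_def set_integrable_def
      by (intro integral_mono) (auto simp: indicator_def)
    also have "\<dots> \<le> C0 powr p * (LINT y|lebesgue. norm (g y) powr p)"
      by (rule C0(3)[OF g])
    also have "(LINT y|lebesgue. norm (g y) powr p) = (2 * r) powr l * morrey_mean p l f x (2 * r)"
      using r by (subst set_integral_eq_morrey_mean[symmetric])
        (auto simp: g_def norm_cutoff_powr set_lebesgue_integral_def)
    finally have "morrey_mean p l (singular_integral K f) x r \<le> 1 / r powr l *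
        (2 powr p * (C0 powr p * ((2 * r) powr l * morrey_mean p l f x (2 * r)) + r powr real DIM('a) * w * E powr p))"
      unfolding morrey_mean_def[of p l "singular_integral K f"] by (intro mult_left_mono) auto
    also have "\<dots> = (2 * (C0 * 2 powr (l / p))) powr p * morrey_mean p l f x (2 * r) +
        (2 * (far_const * w powr (1 / p) * ?D)) powr p"
    proof -
      \<comment> \<open>Since \<open>s * p\<close> is the dimension minus \<open>l\<close>, the far
        part scales exactly as the normalising factor \<open>r powr l\<close>.\<close>
      have "r powr real DIM('a) * (r powr (- s)) powr p = r powr l"
        using r p by (simp add: powr_powr s_def flip: powr_add)
      then have "r powr real DIM('a) * w * E powr p = r powr l * (far_const * w powr (1 / p) * ?D) powr p"
        using p D far_const_nonneg
        by (simp add: E_def powr_mult powr_powr w_def)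
      then show ?thesis
        using r p C0(1) D far_const_nonneg by (simp add: powr_mult powr_powr field_simps w_def)
    qed
    finally have "morrey_mean p l (singular_integral K f) x r powr (1 / p) \<le>
        ((2 * (C0 * 2 powr (l / p))) powr p * morrey_mean p l f x (2 * r) +
        (2 * (far_const * w powr (1 / p) * ?D)) powr p) powr (1 / p)"
      using p by (intro powr_mono2 morrey_mean_nonneg) auto
    also have "\<dots> \<le> ((2 * (C0 * 2 powr (l / p))) powr p * morrey_mean p l f x (2 * r)) powr (1 / p) +
        ((2 * (far_const * w powr (1 / p) * ?D)) powr p) powr (1 / p)"
      using p by (intro add_powr_inverse_le) (auto simp: morrey_mean_nonneg)
    also have "\<dots> = 2 * (C0 * 2 powr (l / p)) * morrey_mean p l f x (2 * r) powr (1 / p) +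
        2 * (far_const * w powr (1 / p) * ?D)"
      using p C0(1) D far_const_nonneg
      by (simp add: powr_mult[of _ _ "1 / p"] powr_powr morrey_mean_nonneg w_def)
    also have "\<dots> \<le> C * ?D"
      using first_le_dyadic_morrey_sum[OF f p l r, of x] C0(1)
      by (simp add: C_def distrib_left distrib_right mult.assoc mult_left_mono)
    finally show ?thesis using Sf by simp
  qed
  have "0 \<le> C"
    using C0(1) far_const_nonneg by (simp add: C_def)
  then show ?thesis
    using main by blast
qed

end

section \<open>The vanishing properties\<close>

text \<open>Eventual boundedness makes the real supremum a genuine upper bound, and nonnegativity at
  any one point keeps it from being negative. This replaces suprema by uniform smallness.\<close>

lemma SUP_tendsto_0_iff:
  fixes u :: "'i \<Rightarrow> 'x \<Rightarrow> real"
  assumes "\<And>t x. 0 \<le> u t x" and bdd: "\<forall>\<^sub>F t in F. bdd_above (range (u t))"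
  shows "((\<lambda>t. SUP x. u t x) \<longlongrightarrow> 0) F \<longleftrightarrow> (\<forall>e>0. \<forall>\<^sub>F t in F. \<forall>x. u t x \<le> e)"
proof
  assume L: "((\<lambda>t. SUP x. u t x) \<longlongrightarrow> 0) F"
  show "\<forall>e>0. \<forall>\<^sub>F t in F. \<forall>x. u t x \<le> e"
  proof (intro allI impI)
    fix e :: real assume "0 < e"
    from tendstoD[OF L this] bdd show "\<forall>\<^sub>F t in F. \<forall>x. u t x \<le> e"
    proof eventually_elim
      case (elim t)
      show ?case
      proof
        fix x
        have "u t x \<le> (SUP x. u t x)" using elim(2) by (intro cSUP_upper) auto
        then show "u t x \<le> e" using elim(1) by simp
      qed
    qed
  qed
next
  assume R: "\<forall>e>0. \<forall>\<^sub>F t in F. \<forall>x. u t x \<le> e"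
  show "((\<lambda>t. SUP x. u t x) \<longlongrightarrow> 0) F"
  proof (rule tendstoI)
    fix e :: real assume "0 < e"
    then have "\<forall>\<^sub>F t in F. \<forall>x. u t x \<le> e / 2"
      using R by (simp only: half_gt_zero)
    with bdd show "\<forall>\<^sub>F t in F. dist (SUP x. u t x) 0 < e"
    proof eventually_elim
      case (elim t)
      have "u t undefined \<le> (SUP x. u t x)" using elim(1) by (intro cSUP_upper) auto
      moreover have "(SUP x. u t x) \<le> e / 2" using elim(2) by (intro cSUP_least) auto
      ultimately show ?case using assms(1)[of t undefined] \<open>0 < e\<close> by simp
    qed
  qed
qed

section \<open>The vanishing conditions as uniform smallness of Morrey means\<close>

lemma bdd_above_morrey_mean:
  assumes "f \<in> morrey_space p l" "1 < p" "0 < r"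
  shows "bdd_above (range (\<lambda>x. morrey_mean p l f x r))"
  using morrey_mean_le_norm[OF assms] by (intro bdd_aboveI2)

lemma vanishing_zero_iff:
  assumes "f \<in> morrey_space p l" "1 < p"
  shows "vanishing_zero p l f \<longleftrightarrow> (\<forall>e>0. \<forall>\<^sub>F r in at_right 0. \<forall>x. morrey_mean p l f x r \<le> e)"
  unfolding vanishing_zero_def
  by (intro SUP_tendsto_0_iff morrey_mean_nonneg eventually_at_rightI[of 0 1] bdd_above_morrey_mean assms) auto

lemma vanishing_infinity_iff:
  assumes "f \<in> morrey_space p l" "1 < p"
  shows "vanishing_infinity p l f \<longleftrightarrow> (\<forall>e>0. \<forall>\<^sub>F r in at_top. \<forall>x. morrey_mean p l f x r \<le> e)"
  unfolding vanishing_infinity_def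
  by (intro SUP_tendsto_0_iff morrey_mean_nonneg eventually_mono[OF eventually_gt_at_top[of 0]]
      bdd_above_morrey_mean assms)

lemma morrey_mean_1:
  "morrey_mean p l f x 1 = (LINT y:ball x 1|lebesgue. norm (f y) powr p)"
  by (simp add: morrey_mean_def)

lemma star_integral_le:
  assumes "locally_p_integrable p f"
  shows "(LINT y:ball x 1|lebesgue. norm (f y) powr p * indicator (UNIV - ball 0 N) y) \<le> morrey_mean p l f x 1"
proof -
  have int: "integrable lebesgue (\<lambda>y. indicator (ball x 1) y *\<^sub>R (norm (f y) powr p))"
    using locally_p_integrableD(2)[OF assms, of x 1] by (simp add: set_integrable_def)
  have "integrable lebesgue (\<lambda>y. indicator (- ball 0 N) y *\<^sub>R (indicator (ball x 1) y *\<^sub>R (norm (f y) powr p)))"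
    by (intro integrable_mult_indicator int) auto
  then have "(\<integral>y. indicator (- ball 0 N) y *\<^sub>R (indicator (ball x 1) y *\<^sub>R (norm (f y) powr p)) \<partial>lebesgue) \<le>
      (\<integral>y. indicator (ball x 1) y *\<^sub>R (norm (f y) powr p) \<partial>lebesgue)"
    by (intro integral_mono int) (auto simp: indicator_def)
  then show ?thesis
    unfolding morrey_mean_1 set_lebesgue_integral_def by (simp add: Compl_eq_Diff_UNIV mult_ac)
qed

text \<open>A unit ball whose centre has norm at least \<open>N + 1\<close> misses the ball of
  radius \<open>N\<close> around 0, and one whose centre has norm at most \<open>N - 1\<close> lies
  inside it. Restricting the integrand thus amounts, up to a shift by 1, to restricting the centres,
  a form fit for \<open>singular_integral_small\<close>.\<close>

lemma vanishing_star_iff: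
  assumes f: "f \<in> morrey_space p l" and p: "1 < p"
  shows "vanishing_star p f \<longleftrightarrow> (\<forall>e>0. \<forall>\<^sub>F N in at_top. \<forall>x. N \<le> norm x \<longrightarrow> morrey_mean p l f x 1 \<le> e)"
proof -
  define u where "u N x = (LINT y:ball x 1|lebesgue. norm (f y) powr p * indicator (UNIV - ball 0 N) y)" for N x
  have u0: "0 \<le> u N x" for N x
    unfolding u_def set_lebesgue_integral_def by simp
  have le: "u N x \<le> morrey_mean p l f x 1" for N x
    unfolding u_def by (rule star_integral_le[OF morrey_spaceD(1)[OF f]])
  have far: "u N x = morrey_mean p l f x 1" if "N + 1 \<le> norm x" for N x
  proof -
    have "y \<notin> ball 0 N" if "y \<in> ball x 1" for y
      using that \<open>N + 1 \<le> norm x\<close> norm_triangle_ineq2[of x y] by (auto simp: dist_norm)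
    then show ?thesis
      unfolding u_def morrey_mean_1 set_lebesgue_integral_def
      by (intro Bochner_Integration.integral_cong) (auto simp: indicator_def)
  qed
  have near: "u N x = 0" if "norm x \<le> N - 1" for N x
  proof -
    have "y \<in> ball 0 N" if "y \<in> ball x 1" for y
      using that \<open>norm x \<le> N - 1\<close> norm_triangle_ineq2[of y x] by (auto simp: dist_norm norm_minus_commute)
    then have "indicat_real (ball x 1) y *\<^sub>R (norm (f y) powr p * indicator (UNIV - ball 0 N) y) = 0" for y
      by (auto simp: indicator_def)
    then show ?thesis
      unfolding u_def set_lebesgue_integral_def by (simp only: Bochner_Integration.integral_zero)
  qed
  have "bdd_above (range (u N))" for N
    using le morrey_mean_le_norm[OF f p, of 1] by (intro bdd_aboveI2) (auto intro: order_trans)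
  then have "vanishing_star p f \<longleftrightarrow> (\<forall>e>0. \<forall>\<^sub>F N in at_top. \<forall>x. u N x \<le> e)"
    unfolding vanishing_star_def u_def[symmetric] by (intro SUP_tendsto_0_iff u0) auto
  also have "\<dots> \<longleftrightarrow> (\<forall>e>0. \<forall>\<^sub>F N in at_top. \<forall>x. N \<le> norm x \<longrightarrow> morrey_mean p l f x 1 \<le> e)"
  proof (intro all_cong iffI)
    fix e :: real
    assume "\<forall>\<^sub>F N in at_top. \<forall>x. u N x \<le> e"
    then obtain N0 where N0: "\<And>N x. N0 \<le> N \<Longrightarrow> u N x \<le> e"
      by (auto simp: eventually_at_top_linorder)
    then have "morrey_mean p l f x 1 \<le> e" if "N0 + 1 \<le> norm x" for x
      using N0[of N0 x] far[OF that] by simp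
    then show "\<forall>\<^sub>F N in at_top. \<forall>x. N \<le> norm x \<longrightarrow> morrey_mean p l f x 1 \<le> e"
      by (intro eventually_mono[OF eventually_ge_at_top[of "N0 + 1"]]) auto
  next
    fix e :: real
    assume e: "0 < e" and "\<forall>\<^sub>F N in at_top. \<forall>x. N \<le> norm x \<longrightarrow> morrey_mean p l f x 1 \<le> e"
    then obtain N0 where N0: "\<And>x. N0 \<le> norm x \<Longrightarrow> morrey_mean p l f x 1 \<le> e"
      by (auto simp: eventually_at_top_linorder)
    \<comment> \<open>Either the integral vanishes, or the centre has norm above
      \<open>N - 1 \<ge> N0\<close> and the full mean is already small.\<close>
    have "u N x \<le> e" if "N0 + 1 \<le> N" for N x
    proof (cases "norm x \<le> N - 1")
      case True then show ?thesis using near e by simp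
    next
      case False then show ?thesis using le[of N x] N0[of x] that by simp
    qed
    then show "\<forall>\<^sub>F N in at_top. \<forall>x. u N x \<le> e"
      by (intro eventually_mono[OF eventually_ge_at_top[of "N0 + 1"]]) auto
  qed
  finally show ?thesis .
qed

text \<open>By translation invariance the number of unit balls needed to cover a ball depends only on its radius.\<close>
lemma morrey_mean_cover:
  fixes R :: real
  assumes R: "0 < R"
  obtains m :: nat where
    "\<And>(f :: 'a::euclidean_space \<Rightarrow> 'b::euclidean_space) x t. locally_p_integrable p f \<Longrightarrow>
      (\<And>z. norm (z - x) \<le> R \<Longrightarrow> morrey_mean p l f z 1 \<le> t) \<Longrightarrow>
      morrey_mean p l f x R \<le> real m * t / R powr l"
proof -
  \<comment> \<open>Total boundedness supplies the centres; having them in \<open>cball 0 R\<close>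
    keeps the translates \<open>x + z\<close> within reach of the smallness assumption.\<close>
  obtain Z :: "'a set" where Z: "finite Z" "Z \<subseteq> cball 0 R" "cball 0 R \<subseteq> (\<Union>z\<in>Z. ball z 1)"
    using seq_compact_imp_totally_bounded[of "cball (0::'a) R"] zero_less_one
      compact_imp_seq_compact[OF compact_cball] by blast
  show thesis
  proof
    fix f :: "'a \<Rightarrow> 'b" and x t
    assume f: "locally_p_integrable p f"
      and small: "\<And>z. norm (z - x) \<le> R \<Longrightarrow> morrey_mean p l f z 1 \<le> t"
    have int: "integrable lebesgue (\<lambda>y. indicat_real (ball z s) y *\<^sub>R (norm (f y) powr p))" for z s
      using locally_p_integrableD(2)[OF f] by (simp add: set_integrable_def)
    have ptw: "indicat_real (ball x R) y *\<^sub>R (norm (f y) powr p) \<le>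
        (\<Sum>z\<in>Z. indicat_real (ball (x + z) 1) y *\<^sub>R (norm (f y) powr p))" for y
    proof (cases "y \<in> ball x R")
      case True
      then have "y - x \<in> cball 0 R" by (simp add: dist_norm norm_minus_commute)
      then obtain z where z: "z \<in> Z" "y - x \<in> ball z 1" using Z(3) by blast
      then have "y \<in> ball (x + z) 1" by (simp add: dist_norm algebra_simps)
      then have "indicat_real (ball x R) y *\<^sub>R (norm (f y) powr p) =
          indicat_real (ball (x + z) 1) y *\<^sub>R (norm (f y) powr p)"
        using True by simp
      also have "\<dots> \<le> (\<Sum>z\<in>Z. indicat_real (ball (x + z) 1) y *\<^sub>R (norm (f y) powr p))"
        by (rule member_le_sum[OF z(1) _ Z(1)]) simp
      finally show ?thesis .
    qed (simp add: sum_nonneg)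
    have "(LINT y:ball x R|lebesgue. norm (f y) powr p) \<le>
        (\<integral>y. (\<Sum>z\<in>Z. indicat_real (ball (x + z) 1) y *\<^sub>R (norm (f y) powr p)) \<partial>lebesgue)"
      unfolding set_lebesgue_integral_def by (intro integral_mono int ptw Bochner_Integration.integrable_sum)
    also have "\<dots> = (\<Sum>z\<in>Z. morrey_mean p l f (x + z) 1)"
      unfolding morrey_mean_1 set_lebesgue_integral_def by (intro Bochner_Integration.integral_sum int)
    also have "\<dots> \<le> (\<Sum>z\<in>Z. t)"
      using Z(2) by (intro sum_mono small) auto
    finally show "morrey_mean p l f x R \<le> real (card Z) * t / R powr l"
      by (simp add: morrey_mean_def divide_right_mono)
  qed
qed

section \<open>Transfer of boundedness and of the vanishing conditions to the singular
  integral\<close>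

context bounded_singular_integral
begin

lemma singular_integral_morrey:
  obtains C where "0 \<le> C"
    "\<And>f. f \<in> morrey_space p l \<Longrightarrow> singular_integral K f \<in> morrey_space p l"
    "\<And>f. f \<in> morrey_space p l \<Longrightarrow> morrey_norm p l (singular_integral K f) \<le> C * morrey_norm p l f"
proof -
  obtain C where C: "0 \<le> C"
    "\<And>f x r. f \<in> morrey_space p l \<Longrightarrow> 0 < r \<Longrightarrow>
       set_integrable lebesgue (ball x r) (\<lambda>y. norm (singular_integral K f y) powr p)"
    "\<And>f x r. f \<in> morrey_space p l \<Longrightarrow> 0 < r \<Longrightarrow>
       morrey_mean p l (singular_integral K f) x r powr (1 / p) \<le> C * dyadic_morrey_sum p l f x r"
    using singular_integral_local by blast
  define q where "q = 2 powr (- ((real DIM('a) - l) / p))"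
  have q: "q < 1" using dyadic_ratio[OF p l] by (simp add: q_def)
  have bound: "morrey_mean p l (singular_integral K f) x r powr (1 / p) \<le> C / (1 - q) * morrey_norm p l f"
    if f: "f \<in> morrey_space p l" and r: "0 < r" for f x r
  proof -
    \<comment> \<open>The case \<open>e = 0\<close>, \<open>m = 0\<close> of
      \<open>dyadic_morrey_sum_le\<close>, whose smallness assumption is then vacuous.\<close>
    have "C * dyadic_morrey_sum p l f x r \<le> C * (morrey_norm p l f / (1 - q))"
      using dyadic_morrey_sum_le[OF f p l r, of 0 0 x] C(1) by (intro mult_left_mono) (auto simp: q_def)
    then show ?thesis
      using C(3)[OF f r, of x] by simp
  qed
  show thesis
  proof
    show "0 \<le> C / (1 - q)" using C(1) q by simp
    fix f :: "'a \<Rightarrow> 'b" assume f: "f \<in> morrey_space p l"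
    have "locally_p_integrable p (singular_integral K f)"
      unfolding locally_p_integrable_def
    proof (intro conjI allI impI singular_integral_measurable f)
      fix S :: "'a set" assume S: "compact S"
      then obtain R where R: "0 < R" "S \<subseteq> ball 0 R"
        using bounded_subset_ballD compact_imp_bounded by blast
      show "set_integrable lebesgue S (\<lambda>y. norm (singular_integral K f y) powr p)"
        using set_integrable_subset[OF C(2)[OF f R(1)] _ R(2)] lmeasurable_compact[OF S] by blast
    qed
    then show "singular_integral K f \<in> morrey_space p l"
      using bound[OF f] by (auto simp: morrey_space_def intro!: bdd_aboveI2)
    show "morrey_norm p l (singular_integral K f) \<le> C / (1 - q) * morrey_norm p l f"
      unfolding morrey_norm_def[of p l "singular_integral K f"]
      using bound[OF f] by (intro cSUP_least) auto
  qed
qed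

text \<open>A form of Tannery's theorem that serves all three vanishing conditions: \<open>A t\<close> is the set of
  balls, given by centre and radius, over which the supremum with parameter \<open>t\<close> is taken.\<close>
lemma singular_integral_small:
  fixes A :: "'i \<Rightarrow> 'a \<Rightarrow> real \<Rightarrow> bool"
  assumes f: "f \<in> morrey_space p l"
    and pos: "\<forall>\<^sub>F t in F. \<forall>x r. A t x r \<longrightarrow> 0 < r"
    and small: "\<And>k e. 0 < e \<Longrightarrow>
      \<forall>\<^sub>F t in F. \<forall>x r. A t x r \<longrightarrow> morrey_mean p l f x (2 ^ (k + 1) * r) \<le> e"
    and e: "0 < e"
  shows "\<forall>\<^sub>F t in F. \<forall>x r. A t x r \<longrightarrow> morrey_mean p l (singular_integral K f) x r \<le> e"
proof -
  obtain C where C: "0 \<le> C"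
    "\<And>f x r. f \<in> morrey_space p l \<Longrightarrow> 0 < r \<Longrightarrow>
       set_integrable lebesgue (ball x r) (\<lambda>y. norm (singular_integral K f y) powr p)"
    "\<And>f x r. f \<in> morrey_space p l \<Longrightarrow> 0 < r \<Longrightarrow>
       morrey_mean p l (singular_integral K f) x r powr (1 / p) \<le> C * dyadic_morrey_sum p l f x r"
    using singular_integral_local by blast
  define q where "q = 2 powr (- ((real DIM('a) - l) / p))"
  have q: "0 < q" "q < 1" using dyadic_ratio[OF p l] by (auto simp: q_def)
  \<comment> \<open>Head and tail of the series are to contribute at most \<open>d / (1 - q)\<close>
    each, so the sum is at most \<open>b\<close>, and \<open>C * b \<le> e powr (1 / p)\<close>. The
    \<open>+ 1\<close> covers \<open>C = 0\<close>.\<close>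
  define b where "b = e powr (1 / p) / (C + 1)"
  define d where "d = b * (1 - q) / 2"
  have d: "0 < d" using e q C(1) by (simp add: d_def b_def)
  have "(\<lambda>m. q ^ m * morrey_norm p l f) \<longlonglongrightarrow> 0"
    using q by (intro tendsto_mult_left_zero LIMSEQ_power_zero) simp
  then have "\<forall>\<^sub>F m in sequentially. q ^ m * morrey_norm p l f < d"
    using d by (rule order_tendstoD)
  then obtain m where m: "q ^ m * morrey_norm p l f < d"
    by (auto simp: eventually_sequentially)
  \<comment> \<open>Only the finitely many indices below \<open>m\<close> need smallness, so the
    eventual statements can be combined.\<close>
  have "\<forall>\<^sub>F t in F. \<forall>k\<in>{..<m}. \<forall>x r. A t x r \<longrightarrow> morrey_mean p l f x (2 ^ (k + 1) * r) \<le> d powr p"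
    using d by (intro eventually_ball_finite ballI small) auto
  with pos show ?thesis
  proof eventually_elim
    case (elim t)
    show ?case
    proof (intro allI impI)
      fix x r assume "A t x r"
      then have r: "0 < r" and le: "\<And>k. k < m \<Longrightarrow> morrey_mean p l f x (2 ^ (k + 1) * r) \<le> d powr p"
        using elim by auto
      have "morrey_mean p l f x (2 ^ (k + 1) * r) powr (1 / p) \<le> d" if "k < m" for k
      proof -
        have "morrey_mean p l f x (2 ^ (k + 1) * r) powr (1 / p) \<le> (d powr p) powr (1 / p)"
          using p le[OF that] by (intro powr_mono2 morrey_mean_nonneg) auto
        then show ?thesis using p d by (simp add: powr_powr)
      qed
      then have "dyadic_morrey_sum p l f x r \<le> (d + q ^ m * morrey_norm p l f) / (1 - q)"
        using d unfolding q_def by (intro dyadic_morrey_sum_le[OF f p l r]) auto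
      also have "\<dots> \<le> 2 * d / (1 - q)"
        using m q by (intro divide_right_mono) auto
      also have "\<dots> = b"
        using q by (simp add: d_def)
      finally have "C * dyadic_morrey_sum p l f x r \<le> C * b"
        using C(1) by (intro mult_left_mono)
      also have "\<dots> \<le> e powr (1 / p)"
        using C(1) by (simp add: b_def field_simps)
      finally have "morrey_mean p l (singular_integral K f) x r powr (1 / p) \<le> e powr (1 / p)"
        using C(3)[OF f r, of x] by linarith
      then have "(morrey_mean p l (singular_integral K f) x r powr (1 / p)) powr p \<le> (e powr (1 / p)) powr p"
        using p by (auto intro: powr_mono2[of p])
      then show "morrey_mean p l (singular_integral K f) x r \<le> e"
        using p e morrey_mean_nonneg[of p l "singular_integral K f" x r] by (simp add: powr_powr)
    qed
  qed
qed

lemma singular_integral_vanishing_zero: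
  assumes f: "f \<in> morrey_space p l" and v: "vanishing_zero p l f"
    and Sf: "singular_integral K f \<in> morrey_space p l"
  shows "vanishing_zero p l (singular_integral K f)"
  unfolding vanishing_zero_iff[OF Sf p]
proof (intro allI impI)
  fix e :: real assume e: "0 < e"
  have "\<forall>\<^sub>F t in at_right 0. \<forall>x r. r = t \<longrightarrow> morrey_mean p l (singular_integral K f) x r \<le> e"
  proof (rule singular_integral_small[OF f _ _ e])
    show "\<forall>\<^sub>F t in at_right 0. \<forall>(x::'a) r. r = t \<longrightarrow> 0 < (r::real)"
      by (intro eventually_at_rightI[of 0 1]) auto
    fix k and e' :: real assume "0 < e'"
    then have "\<forall>\<^sub>F r in at_right 0. \<forall>x. morrey_mean p l f x r \<le> e'"
      using v vanishing_zero_iff[OF f p] by blast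
    moreover have "filterlim (\<lambda>t::real. 2 ^ (k + 1) * t) (at_right 0) (at_right 0)"
      by (rule filterlim_times_pos[OF filterlim_ident]) auto
    ultimately have "\<forall>\<^sub>F t in at_right 0. \<forall>x. morrey_mean p l f x (2 ^ (k + 1) * t) \<le> e'"
      by (rule eventually_compose_filterlim)
    then show "\<forall>\<^sub>F t in at_right 0. \<forall>x r. r = t \<longrightarrow> morrey_mean p l f x (2 ^ (k + 1) * r) \<le> e'"
      by simp
  qed
  then show "\<forall>\<^sub>F r in at_right 0. \<forall>x. morrey_mean p l (singular_integral K f) x r \<le> e"
    by simp
qed

lemma singular_integral_vanishing_infinity:
  assumes f: "f \<in> morrey_space p l" and v: "vanishing_infinity p l f"
    and Sf: "singular_integral K f \<in> morrey_space p l"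
  shows "vanishing_infinity p l (singular_integral K f)"
  unfolding vanishing_infinity_iff[OF Sf p]
proof (intro allI impI)
  fix e :: real assume e: "0 < e"
  have "\<forall>\<^sub>F t in at_top. \<forall>x r. r = t \<longrightarrow> morrey_mean p l (singular_integral K f) x r \<le> e"
  proof (rule singular_integral_small[OF f _ _ e])
    show "\<forall>\<^sub>F t in at_top. \<forall>(x::'a) r. r = t \<longrightarrow> 0 < (r::real)"
      by (intro eventually_mono[OF eventually_gt_at_top[of 0]]) auto
    fix k and e' :: real assume "0 < e'"
    then have "\<forall>\<^sub>F r in at_top. \<forall>x. morrey_mean p l f x r \<le> e'"
      using v vanishing_infinity_iff[OF f p] by blast
    moreover have "filterlim (\<lambda>t::real. 2 ^ (k + 1) * t) at_top at_top"
      by (rule filterlim_tendsto_pos_mult_at_top[OF tendsto_const _ filterlim_ident]) auto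
    ultimately have "\<forall>\<^sub>F t in at_top. \<forall>x. morrey_mean p l f x (2 ^ (k + 1) * t) \<le> e'"
      by (rule eventually_compose_filterlim)
    then show "\<forall>\<^sub>F t in at_top. \<forall>x r. r = t \<longrightarrow> morrey_mean p l f x (2 ^ (k + 1) * r) \<le> e'"
      by simp
  qed
  then show "\<forall>\<^sub>F r in at_top. \<forall>x. morrey_mean p l (singular_integral K f) x r \<le> e"
    by simp
qed

text \<open>The relevant balls are unit balls with distant centres. Their dilates have fixed radius
  \<open>R\<close> for each \<open>k\<close> and are covered by a fixed number of unit balls, whose
  centres are still distant.\<close>

lemma singular_integral_vanishing_star:
  assumes f: "f \<in> morrey_space p l" and v: "vanishing_star p f"
    and Sf: "singular_integral K f \<in> morrey_space p l"
  shows "vanishing_star p (singular_integral K f)"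
  unfolding vanishing_star_iff[OF Sf p]
proof (intro allI impI)
  fix e :: real assume e: "0 < e"
  have "\<forall>\<^sub>F N in at_top. \<forall>x r. N \<le> norm x \<and> r = 1 \<longrightarrow> morrey_mean p l (singular_integral K f) x r \<le> e"
  proof (rule singular_integral_small[OF f _ _ e])
    fix k and e' :: real assume e': "0 < e'"
    define R :: real where "R = 2 ^ (k + 1)"
    have R: "0 < R" by (simp add: R_def)
    obtain m where m: "\<And>x t. (\<And>z. norm (z - x) \<le> R \<Longrightarrow> morrey_mean p l f z 1 \<le> t) \<Longrightarrow>
        morrey_mean p l f x R \<le> real m * t / R powr l"
      using morrey_mean_cover[OF R] morrey_spaceD(1)[OF f] by metis
    \<comment> \<open>Chosen so that the covering bound becomes \<open>e' * (m / (m + 1))\<close>;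
      the \<open>+ 1\<close> covers \<open>m = 0\<close>.\<close>
    define t where "t = e' * R powr l / (real m + 1)"
    have "0 < t" using e' R by (simp add: t_def)
    then have "\<forall>\<^sub>F N in at_top. \<forall>z. N \<le> norm z \<longrightarrow> morrey_mean p l f z 1 \<le> t"
      using v vanishing_star_iff[OF f p] by blast
    then obtain N0 where N0: "\<And>z. N0 \<le> norm z \<Longrightarrow> morrey_mean p l f z 1 \<le> t"
      by (auto simp: eventually_at_top_linorder)
    \<comment> \<open>The margin \<open>R\<close> keeps every centre within distance
      \<open>R\<close> of \<open>x\<close> at norm at least \<open>N0\<close>.\<close>
    have "morrey_mean p l f x R \<le> e'" if x: "N0 + R \<le> norm x" for x
    proof -
      have "morrey_mean p l f x R \<le> real m * t / R powr l"
      proof (rule m, rule N0)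
        fix z assume "norm (z - x) \<le> R"
        then show "N0 \<le> norm z"
          using x norm_triangle_ineq2[of x z] by (simp add: norm_minus_commute)
      qed
      also have "\<dots> = e' * (real m / (real m + 1))"
        using R by (simp add: t_def)
      also have "\<dots> \<le> e' * 1"
        using e' by (intro mult_left_mono) auto
      finally show ?thesis by simp
    qed
    then show "\<forall>\<^sub>F N in at_top. \<forall>x r. N \<le> norm x \<and> r = 1 \<longrightarrow> morrey_mean p l f x (2 ^ (k + 1) * r) \<le> e'"
      by (intro eventually_mono[OF eventually_ge_at_top[of "N0 + R"]]) (auto simp: R_def)
  qed simp
  then show "\<forall>\<^sub>F N in at_top. \<forall>x. N \<le> norm x \<longrightarrow> morrey_mean p l (singular_integral K f) x 1 \<le> e"
    by simp
qed

end

text \<open>The existence clause ensures that the values given by \<open>Lim\<close> are almost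
  everywhere genuine limits.\<close>

theorem theorem3p11:
  fixes K :: "real ^ 'n \<Rightarrow> real ^ 'n \<Rightarrow> 'b::{real_normed_field, euclidean_space}"
    and p l c :: real
  assumes "1 < p"
    and "0 \<le> l" and "l < real CARD('n)"
    and "(\<lambda>(x, y). K x y) \<in> borel_measurable lebesgue"
    and "\<And>f. f \<in> Lp_space p \<Longrightarrow> AE x in lebesgue. singular_integral_exists K f x"
    and "bounded_into_itself (Lp_space p) (Lp_norm p) (singular_integral K)"
    and "0 < c" and "\<And>x y. x \<noteq> y \<Longrightarrow> norm (K x y) \<le> c * dist x y powr (- real CARD('n))"
  shows "(\<forall>f\<in>vanishing_morrey_space p l. AE x in lebesgue. singular_integral_exists K f x) \<and>
    bounded_into_itself (vanishing_morrey_space p l) (morrey_norm p l) (singular_integral K)"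
proof -
  interpret bounded_singular_integral K p l c
    using assms by unfold_locales auto
  obtain C where C:
    "\<And>f. f \<in> morrey_space p l \<Longrightarrow> singular_integral K f \<in> morrey_space p l"
    "\<And>f. f \<in> morrey_space p l \<Longrightarrow> morrey_norm p l (singular_integral K f) \<le> C * morrey_norm p l f"
    using singular_integral_morrey by blast
  have "singular_integral K f \<in> vanishing_morrey_space p l" if "f \<in> vanishing_morrey_space p l" for f
    using that C(1)[of f] singular_integral_vanishing_zero[of f] singular_integral_vanishing_infinity[of f]
      singular_integral_vanishing_star[of f]
    by (simp add: vanishing_morrey_space_def)
  then have "bounded_into_itself (vanishing_morrey_space p l) (morrey_norm p l) (singular_integral K)"
    using C(2) unfolding bounded_into_itself_def by (auto simp: vanishing_morrey_space_def)
  moreover have "\<forall>f\<in>vanishing_morrey_space p l. AE x in lebesgue. singular_integral_exists K f x"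
    using exists_morrey by (simp add: vanishing_morrey_space_def)
  ultimately show ?thesis by blast
qed

end
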